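(* Let $\lambda$ be a dominant analytically integral weight of $G$, let $(\pi,\mathcal H_\pi)$ be an irreducible unitary representation of $G$ that occurs in $\sigma^\lambda\otimes\overline{\sigma^\lambda}$, let $v_0\in\mathcal H_\pi^L$ and $u\in\mathcal H_\pi$, and let $\pi_{u,v_0}(x)=\langle u,\pi(x)v_0\rangle$. Then for all $v,w\in\mathcal H_\lambda$, $$\langle v,\ T^\lambda_{\pi_{u,v_0}}w\rangle=\frac{d_\lambda}{d_\pi}\sum_{k=1}^{m(\pi,\sigma^\lambda\otimes\overline{\sigma^\lambda})}\big\langle (v\otimes\overline w)^\pi_k,\ u\big\rangle\,\big\langle v_0,\ (v_\lambda\otimes\overline{v_\lambda})^\pi_k\big\rangle .$$
   Context: $G$ is a compact connected Lie group with normalized Haar measure $dy$, with a fixed maximal torus and a fixed positive root system. $(\sigma^\lambda,\mathcal H_\lambda)$ is the irreducible unitary representation of $G$ with highest weight $\lambda$ (inner products linear in the first variable), $d_\lambda=\dim\mathcal H_\lambda$, $v_\lambda$ a unit highest-weight vector, and $L=\{g\in G:\sigma^\lambda(g)v_\lambda\in\mathbb C v_\lambda\}$. Functions on $G/L$ are identified with right-$L$-invariant functions on $G$. For $f\in L^1(G/L)$ the Toeplitz operator $T^\lambda_f\in\mathrm{End}(\mathcal H_\lambda)$ is given by $$\langle T^\lambda_f v,w\rangle=d_\lambda\int_G f(y)\langle v,\sigma^\lambda(y)v_\lambda\rangle\overline{\langle w,\sigma^\lambda(y)v_\lambda\rangle}\,dy .$$ $d_\pi=\dim\mathcal H_\pi$,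 and $\mathcal H_\pi^L=\{v\in\mathcal H_\pi:\pi(l)v=v\ \forall l\in L\}$; for $v_0\in\mathcal H_\pi^L$ the function $\pi_{u,v_0}$ is right-$L$-invariant. $\overline{\sigma^\lambda}$ is the conjugate representation on the conjugate space $\overline{\mathcal H_\lambda}$, and $m(\pi,\rho)$ denotes the multiplicity of $\pi$ in $\rho$. Fix an orthogonal decomposition $\mathcal H_\lambda\otimes\overline{\mathcal H_\lambda}=\bigoplus_{\rho}(\mathcal H_\rho)^{\oplus m(\rho,\sigma^\lambda\otimes\overline{\sigma^\lambda})}$ into irreducible representations of $G$ (unitary identification, $\rho$ ranging over the irreducible representations occurring); for a vector $z\in\mathcal H_\lambda\otimes\overline{\mathcal H_\lambda}$, $z^\rho_k\in\mathcal H_\rho$ denotes its component in the $k$-th copy of $\mathcal H_\rho$. *)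

theory Defs
  imports "HOL-Analysis.Analysis"
begin

section \<open>Lie groups\<close>

text \<open>
  A Lie group lives on a type of class \<open>topological_group_add\<close>, the library's class of
  (not necessarily commutative) topological groups. The group law is therefore written additively:
  \<open>g + h\<close> is the product \<open>gh\<close>, \<open>0\<close> is the identity element and \<open>- g\<close> the inverse.

  Charts take values in a linear subspace \<open>E\<close> of a Euclidean space rather than in the whole space,
  since types of class \<open>euclidean_space\<close> have positive dimension and the trivial group would
  otherwise be excluded.
\<close>

record ('g, 'e) lie_structure =
  model :: "'e set"
  charts :: "('g set \<times> ('g \<Rightarrow> 'e)) set"

text \<open>
  \<open>Ck_on k E D f\<close>: \<open>f\<close> is of class \<open>C\<^sup>k\<close> on the relatively open subset \<open>D\<close> of the
  subspace \<open>E\<close>. The values \<open>f' x v\<close> are determined by \<open>f\<close> for \<open>v \<in> E\<close> only.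
\<close>

primrec Ck_on :: "nat \<Rightarrow> 'a::euclidean_space set \<Rightarrow> 'a set \<Rightarrow> ('a \<Rightarrow> 'b::euclidean_space) \<Rightarrow> bool"
where
  "Ck_on 0 E D f \<longleftrightarrow> continuous_on D f"
| "Ck_on (Suc k) E D f \<longleftrightarrow>
     (\<exists>f'. (\<forall>x\<in>D. (f has_derivative f' x) (at x within D)) \<and> (\<forall>v\<in>E. Ck_on k E D (\<lambda>x. f' x v)))"

definition smooth_on :: "'a::euclidean_space set \<Rightarrow> 'a set \<Rightarrow> ('a \<Rightarrow> 'b::euclidean_space) \<Rightarrow> bool"
  where "smooth_on E D f \<longleftrightarrow> (\<forall>k. Ck_on k E D f)"

definition smooth_atlas ::
  "('g::{t2_space,second_countable_topology}, 'e::euclidean_space) lie_structure \<Rightarrow> bool"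
where
  "smooth_atlas G \<longleftrightarrow>
     subspace (model G) \<and>
     (\<Union>(U, \<phi>)\<in>charts G. U) = UNIV \<and>
     (\<forall>(U, \<phi>)\<in>charts G. open U \<and> openin (top_of_set (model G)) (\<phi> ` U) \<and>
        homeomorphism U (\<phi> ` U) \<phi> (inv_into U \<phi>)) \<and>
     (\<forall>(U, \<phi>)\<in>charts G. \<forall>(V, \<psi>)\<in>charts G.
        smooth_on (model G) (\<phi> ` (U \<inter> V)) (\<lambda>x. \<psi> (inv_into U \<phi> x)))"

definition lie_group ::
  "('g::{topological_group_add,t2_space,second_countable_topology}, 'e::euclidean_space) lie_structure
     \<Rightarrow> bool"
where
  "lie_group G \<longleftrightarrow>
     smooth_atlas G \<and>
     (\<forall>(U, \<phi>)\<in>charts G. \<forall>(V, \<psi>)\<in>charts G. \<forall>(W, \<theta>)\<in>charts G.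
        smooth_on (model G \<times> model G)
          {(x, y). x \<in> \<phi> ` U \<and> y \<in> \<psi> ` V \<and> inv_into U \<phi> x + inv_into V \<psi> y \<in> W}
          (\<lambda>(x, y). \<theta> (inv_into U \<phi> x + inv_into V \<psi> y))) \<and>
     (\<forall>(U, \<phi>)\<in>charts G. \<forall>(V, \<psi>)\<in>charts G.
        smooth_on (model G) {x \<in> \<phi> ` U. - inv_into U \<phi> x \<in> V} (\<lambda>x. \<psi> (- inv_into U \<phi> x)))"

definition compact_connected_lie_group ::
  "('g::{topological_group_add,t2_space,second_countable_topology}, 'e::euclidean_space) lie_structure
     \<Rightarrow> bool"
where
  "compact_connected_lie_group G \<longleftrightarrow>
     lie_group G \<and> compact (UNIV :: 'g set) \<and> connected (UNIV :: 'g set)"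

definition normalized_haar :: "'g::topological_group_add measure \<Rightarrow> bool" where
  "normalized_haar \<mu> \<longleftrightarrow>
     sets \<mu> = sets borel \<and> emeasure \<mu> UNIV = 1 \<and> (\<forall>g. distr \<mu> borel (\<lambda>x. g + x) = \<mu>)"

section \<open>Lie algebra, maximal tori, roots and weights\<close>

text \<open>
  The Lie algebra (tangent space at the identity) is identified with \<open>model G\<close> by means of some
  chart around the identity; another choice changes everything below by a linear isomorphism.
\<close>

definition id_chart :: "('g::zero, 'e) lie_structure \<Rightarrow> 'g set \<times> ('g \<Rightarrow> 'e)" where
  "id_chart G = (SOME c. c \<in> charts G \<and> 0 \<in> fst c)"

definition one_parameter_subgroup :: "(real \<Rightarrow> 'g::topological_group_add) \<Rightarrow> bool" where
  "one_parameter_subgroup X \<longleftrightarrow> continuous_on UNIV X \<and> (\<forall>s t. X (s + t) = X s + X t)"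

definition lie_exp ::
  "('g::topological_group_add, 'e::euclidean_space) lie_structure \<Rightarrow> 'e \<Rightarrow> 'g"
where
  "lie_exp G \<xi> =
     (THE X. one_parameter_subgroup X \<and>
        ((\<lambda>t. snd (id_chart G) (X t)) has_vector_derivative \<xi>) (at 0)) 1"

text \<open>\<open>Ad g\<close> is the differential at the identity of \<open>x \<mapsto> g x g\<^sup>-\<^sup>1\<close>, in the chart.\<close>

definition Ad ::
  "('g::topological_group_add, 'e::euclidean_space) lie_structure \<Rightarrow> 'g \<Rightarrow> 'e \<Rightarrow> 'e"
where
  "Ad G g \<xi> =
     (let (U, \<phi>) = id_chart G
      in vector_derivative (\<lambda>t. \<phi> (g + inv_into U \<phi> (\<phi> 0 + t *\<^sub>R \<xi>) - g)) (at 0))"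

definition compact_connected_abelian_subgroup :: "'g::topological_group_add set \<Rightarrow> bool" where
  "compact_connected_abelian_subgroup T \<longleftrightarrow>
     0 \<in> T \<and> (\<forall>x\<in>T. \<forall>y\<in>T. x + y \<in> T \<and> x + y = y + x) \<and> (\<forall>x\<in>T. - x \<in> T) \<and>
     compact T \<and> connected T"

definition maximal_torus :: "'g::topological_group_add set \<Rightarrow> bool" where
  "maximal_torus T \<longleftrightarrow>
     compact_connected_abelian_subgroup T \<and>
     (\<forall>S. compact_connected_abelian_subgroup S \<and> T \<subseteq> S \<longrightarrow> S = T)"

definition lie_subalgebra ::
  "('g::topological_group_add, 'e::euclidean_space) lie_structure \<Rightarrow> 'g set \<Rightarrow> 'e set"
where
  "lie_subalgebra G T = {\<xi> \<in> model G. \<forall>t. lie_exp G (t *\<^sub>R \<xi>) \<in> T}"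

text \<open>
  Real-linear functionals on the Lie algebra of \<open>T\<close>, made unique as functions by setting them to
  \<open>0\<close> elsewhere. Weights are real: \<open>\<mu>\<close> stands for the infinitesimal character \<open>\<i>\<mu>\<close>, so that
  \<open>exp \<xi>\<close> acts on a weight vector by \<open>cis (\<mu> \<xi>)\<close>, i.e. by \<open>e\<close> to the power \<open>\<i>\<mu>(\<xi>)\<close>.
\<close>

definition functionals ::
  "('g::topological_group_add, 'e::euclidean_space) lie_structure \<Rightarrow> 'g set \<Rightarrow> ('e \<Rightarrow> real) set"
where
  "functionals G T =
     {\<mu>. (\<forall>\<xi>\<in>lie_subalgebra G T. \<forall>\<eta>\<in>lie_subalgebra G T. \<forall>a b.
            \<mu> (a *\<^sub>R \<xi> + b *\<^sub>R \<eta>) = a * \<mu> \<xi> + b * \<mu> \<eta>) \<and>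
         (\<forall>\<xi>. \<xi> \<notin> lie_subalgebra G T \<longrightarrow> \<mu> \<xi> = 0)}"

definition analytically_integral ::
  "('g::topological_group_add, 'e::euclidean_space) lie_structure \<Rightarrow> 'g set \<Rightarrow> ('e \<Rightarrow> real) \<Rightarrow> bool"
where
  "analytically_integral G T \<mu> \<longleftrightarrow>
     \<mu> \<in> functionals G T \<and>
     (\<forall>\<xi>\<in>lie_subalgebra G T. lie_exp G \<xi> = 0 \<longrightarrow> (\<exists>n::int. \<mu> \<xi> = 2 * pi * of_int n))"

text \<open>
  Roots are the nonzero weights of \<open>T\<close> on the complexified Lie algebra: the two equations below are
  the real and imaginary part of \<open>Ad (exp \<xi>) (x + \<i> y) = cis (\<alpha> \<xi>) (x + \<i> y)\<close>.
\<close>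

definition roots ::
  "('g::topological_group_add, 'e::euclidean_space) lie_structure \<Rightarrow> 'g set \<Rightarrow> ('e \<Rightarrow> real) set"
where
  "roots G T =
     {\<alpha> \<in> functionals G T. \<alpha> \<noteq> (\<lambda>_. 0) \<and>
        (\<exists>x\<in>model G. \<exists>y\<in>model G. \<not> (x = 0 \<and> y = 0) \<and>
          (\<forall>\<xi>\<in>lie_subalgebra G T.
             Ad G (lie_exp G \<xi>) x = cos (\<alpha> \<xi>) *\<^sub>R x - sin (\<alpha> \<xi>) *\<^sub>R y \<and>
             Ad G (lie_exp G \<xi>) y = sin (\<alpha> \<xi>) *\<^sub>R x + cos (\<alpha> \<xi>) *\<^sub>R y))}"

definition positive_system ::
  "('g::topological_group_add, 'e::euclidean_space) lie_structure \<Rightarrow> 'g set \<Rightarrow> ('e \<Rightarrow> real) set \<Rightarrow> bool"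
where
  "positive_system G T P \<longleftrightarrow>
     P \<subseteq> roots G T \<and>
     (\<forall>\<alpha>\<in>roots G T. (\<alpha> \<in> P) \<noteq> ((\<lambda>\<xi>. - \<alpha> \<xi>) \<in> P)) \<and>
     (\<forall>\<alpha>\<in>P. \<forall>\<beta>\<in>P. (\<lambda>\<xi>. \<alpha> \<xi> + \<beta> \<xi>) \<in> roots G T \<longrightarrow> (\<lambda>\<xi>. \<alpha> \<xi> + \<beta> \<xi>) \<in> P)"

definition invariant_inner ::
  "('g::topological_group_add, 'e::euclidean_space) lie_structure \<Rightarrow> ('e \<Rightarrow> 'e \<Rightarrow> real) \<Rightarrow> bool"
where
  "invariant_inner G B \<longleftrightarrow>
     (\<forall>x\<in>model G. \<forall>y\<in>model G. \<forall>z\<in>model G. \<forall>a b.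
        B (a *\<^sub>R x + b *\<^sub>R y) z = a * B x z + b * B y z \<and> B x y = B y x) \<and>
     (\<forall>x\<in>model G. x \<noteq> 0 \<longrightarrow> 0 < B x x) \<and>
     (\<forall>g. \<forall>x\<in>model G. \<forall>y\<in>model G. B (Ad G g x) (Ad G g y) = B x y)"

text \<open>
  \<open>\<langle>\<mu>, \<alpha>\<rangle> \<ge> 0\<close> for all positive roots \<open>\<alpha>\<close>, where the pairing of functionals is induced by an
  invariant inner product \<open>B\<close>: it is \<open>\<mu> h\<close> for the \<open>h\<close> representing \<open>\<alpha>\<close>. Its sign does not
  depend on \<open>B\<close>.
\<close>

definition dominant ::
  "('g::topological_group_add, 'e::euclidean_space) lie_structure \<Rightarrow> 'g set \<Rightarrow> ('e \<Rightarrow> real) set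
     \<Rightarrow> ('e \<Rightarrow> real) \<Rightarrow> bool"
where
  "dominant G T P \<mu> \<longleftrightarrow>
     \<mu> \<in> functionals G T \<and>
     (\<forall>B. invariant_inner G B \<longrightarrow>
        (\<forall>\<alpha>\<in>P. \<forall>h\<in>lie_subalgebra G T. (\<forall>\<xi>\<in>lie_subalgebra G T. B h \<xi> = \<alpha> \<xi>) \<longrightarrow> 0 \<le> \<mu> h))"

section \<open>Unitary representations\<close>

text \<open>
  A finite-dimensional complex Hilbert space is a subspace \<open>vecs\<close> of a complex vector space that
  fills its type. The inner product is linear in the first variable.
\<close>

record 'v hilbert =
  vecs :: "'v set"
  scale :: "complex \<Rightarrow> 'v \<Rightarrow> 'v"
  inner_prod :: "'v \<Rightarrow> 'v \<Rightarrow> complex"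

record ('g, 'v) rep = "'v hilbert" +
  act :: "'g \<Rightarrow> 'v \<Rightarrow> 'v"

definition fd_hilbert :: "('v::ab_group_add, 'z) hilbert_scheme \<Rightarrow> bool" where
  "fd_hilbert H \<longleftrightarrow>
     vector_space (scale H) \<and>
     module.subspace (scale H) (vecs H) \<and>
     (\<exists>B. finite B \<and> vecs H = module.span (scale H) B) \<and>
     (\<forall>x\<in>vecs H. \<forall>y\<in>vecs H. \<forall>z\<in>vecs H. \<forall>c.
        inner_prod H (x + y) z = inner_prod H x z + inner_prod H y z \<and>
        inner_prod H (scale H c x) y = c * inner_prod H x y \<and>
        inner_prod H y x = cnj (inner_prod H x y)) \<and>
     (\<forall>x\<in>vecs H. x \<noteq> 0 \<longrightarrow> 0 < Re (inner_prod H x x))"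

definition hdim :: "('v::ab_group_add, 'z) hilbert_scheme \<Rightarrow> nat" where
  "hdim H = vector_space.dim (scale H) (vecs H)"

definition hnorm :: "('v, 'z) hilbert_scheme \<Rightarrow> 'v \<Rightarrow> real" where
  "hnorm H x = sqrt (Re (inner_prod H x x))"

definition hlinear ::
  "('v::ab_group_add, 'y) hilbert_scheme \<Rightarrow> ('w::ab_group_add, 'z) hilbert_scheme
     \<Rightarrow> ('v \<Rightarrow> 'w) \<Rightarrow> bool"
where
  "hlinear H K f \<longleftrightarrow>
     (\<forall>x\<in>vecs H. f x \<in> vecs K) \<and>
     (\<forall>x\<in>vecs H. \<forall>y\<in>vecs H. f (x + y) = f x + f y) \<and>
     (\<forall>c. \<forall>x\<in>vecs H. f (scale H c x) = scale K c (f x))"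

definition unitary_rep :: "('g::topological_group_add, 'v::ab_group_add) rep \<Rightarrow> bool" where
  "unitary_rep \<sigma> \<longleftrightarrow>
     fd_hilbert \<sigma> \<and>
     (\<forall>g. hlinear \<sigma> \<sigma> (act \<sigma> g)) \<and>
     (\<forall>v\<in>vecs \<sigma>. act \<sigma> 0 v = v) \<and>
     (\<forall>g h. \<forall>v\<in>vecs \<sigma>. act \<sigma> (g + h) v = act \<sigma> g (act \<sigma> h v)) \<and>
     (\<forall>g. \<forall>v\<in>vecs \<sigma>. \<forall>w\<in>vecs \<sigma>.
        inner_prod \<sigma> (act \<sigma> g v) (act \<sigma> g w) = inner_prod \<sigma> v w) \<and>
     (\<forall>v\<in>vecs \<sigma>. \<forall>g. ((\<lambda>h. hnorm \<sigma> (act \<sigma> h v - act \<sigma> g v)) \<longlongrightarrow> 0) (at g))"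

definition irreducible_rep :: "('g::topological_group_add, 'v::ab_group_add) rep \<Rightarrow> bool" where
  "irreducible_rep \<sigma> \<longleftrightarrow>
     unitary_rep \<sigma> \<and> vecs \<sigma> \<noteq> {0} \<and>
     (\<forall>W. module.subspace (scale \<sigma>) W \<and> W \<subseteq> vecs \<sigma> \<and> (\<forall>g. \<forall>w\<in>W. act \<sigma> g w \<in> W)
        \<longrightarrow> W = {0} \<or> W = vecs \<sigma>)"

definition intertwiner ::
  "('g, 'v::ab_group_add) rep \<Rightarrow> ('g, 'w::ab_group_add) rep \<Rightarrow> ('v \<Rightarrow> 'w) \<Rightarrow> bool"
where
  "intertwiner \<sigma> \<tau> f \<longleftrightarrow>
     hlinear \<sigma> \<tau> f \<and> (\<forall>g. \<forall>v\<in>vecs \<sigma>. f (act \<sigma> g v) = act \<tau> g (f v))"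

definition isometric_intertwiner ::
  "('g, 'v::ab_group_add) rep \<Rightarrow> ('g, 'w::ab_group_add) rep \<Rightarrow> ('v \<Rightarrow> 'w) \<Rightarrow> bool"
where
  "isometric_intertwiner \<sigma> \<tau> f \<longleftrightarrow>
     intertwiner \<sigma> \<tau> f \<and>
     (\<forall>v\<in>vecs \<sigma>. \<forall>w\<in>vecs \<sigma>. inner_prod \<tau> (f v) (f w) = inner_prod \<sigma> v w)"

definition equivalent_reps ::
  "('g, 'v::ab_group_add) rep \<Rightarrow> ('g, 'w::ab_group_add) rep \<Rightarrow> bool"
where
  "equivalent_reps \<sigma> \<tau> \<longleftrightarrow> (\<exists>f. isometric_intertwiner \<sigma> \<tau> f \<and> f ` vecs \<sigma> = vecs \<tau>)"

text \<open>For irreducible \<open>\<pi>\<close>: \<open>\<pi>\<close> is equivalent to a subrepresentation of \<open>\<tau>\<close>.\<close>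

definition occurs_in ::
  "('g, 'v::ab_group_add) rep \<Rightarrow> ('g, 'w::ab_group_add) rep \<Rightarrow> bool"
where
  "occurs_in \<pi> \<tau> \<longleftrightarrow> (\<exists>J. isometric_intertwiner \<pi> \<tau> J)"

text \<open>The largest \<open>n\<close> such that the \<open>n\<close>-fold orthogonal sum of \<open>\<pi>\<close> embeds into \<open>\<tau>\<close>.\<close>

definition rep_multiplicity ::
  "('g, 'v::ab_group_add) rep \<Rightarrow> ('g, 'w::ab_group_add) rep \<Rightarrow> nat"
where
  "rep_multiplicity \<pi> \<tau> =
     (GREATEST n. \<exists>J. (\<forall>k<n. isometric_intertwiner \<pi> \<tau> (J k)) \<and>
        (\<forall>k<n. \<forall>l<n. k \<noteq> l \<longrightarrow>
           (\<forall>v\<in>vecs \<pi>. \<forall>w\<in>vecs \<pi>. inner_prod \<tau> (J k v) (J l w) = 0)))"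

text \<open>
  The conjugate space has the same vectors, \<open>v\<close> playing the role of \<open>v\<close> conjugate; applied to a
  representation this gives the conjugate representation, with unchanged action.
\<close>

definition conjugate :: "('v, 'z) hilbert_scheme \<Rightarrow> ('v, 'z) hilbert_scheme" where
  "conjugate H =
     H\<lparr>scale := (\<lambda>c. scale H (cnj c)), inner_prod := (\<lambda>v w. inner_prod H w v)\<rparr>"

text \<open>
  \<open>\<tau>\<close> together with the bilinear map \<open>tens\<close> is a tensor product of \<open>\<sigma>\<close> and \<open>\<rho>\<close>. These conditions
  determine \<open>\<tau>\<close> and \<open>tens\<close> up to a unique unitary isomorphism compatible with \<open>tens\<close>.
\<close>

definition tensor_product ::
  "('g::topological_group_add, 'v::ab_group_add) rep \<Rightarrow> ('g, 'w::ab_group_add) rep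
     \<Rightarrow> ('g, 't::ab_group_add) rep \<Rightarrow> ('v \<Rightarrow> 'w \<Rightarrow> 't) \<Rightarrow> bool"
where
  "tensor_product \<sigma> \<rho> \<tau> tens \<longleftrightarrow>
     unitary_rep \<tau> \<and>
     (\<forall>w\<in>vecs \<rho>. hlinear \<sigma> \<tau> (\<lambda>v. tens v w)) \<and>
     (\<forall>v\<in>vecs \<sigma>. hlinear \<rho> \<tau> (tens v)) \<and>
     vecs \<tau> = module.span (scale \<tau>) {tens v w | v w. v \<in> vecs \<sigma> \<and> w \<in> vecs \<rho>} \<and>
     (\<forall>v\<in>vecs \<sigma>. \<forall>v'\<in>vecs \<sigma>. \<forall>w\<in>vecs \<rho>. \<forall>w'\<in>vecs \<rho>.
        inner_prod \<tau> (tens v w) (tens v' w') = inner_prod \<sigma> v v' * inner_prod \<rho> w w') \<and>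
     (\<forall>g. \<forall>v\<in>vecs \<sigma>. \<forall>w\<in>vecs \<rho>. act \<tau> g (tens v w) = tens (act \<sigma> g v) (act \<rho> g w))"

text \<open>
  \<open>R\<close> is a system of representatives of the irreducible representations occurring in \<open>\<tau>\<close>, and
  \<open>z \<mapsto> (proj \<rho> k z)\<close>, with \<open>\<rho> \<in> R\<close> and \<open>1 \<le> k \<le> rep_multiplicity \<rho> \<tau>\<close>, is a unitary
  \<open>G\<close>-equivariant isomorphism from \<open>\<tau>\<close> onto the orthogonal direct sum of the copies of the \<open>\<rho>\<close>'s.
\<close>

definition irreducible_decomposition ::
  "('g::topological_group_add, 't::ab_group_add) rep \<Rightarrow> ('g, 'p::ab_group_add) rep set
     \<Rightarrow> (('g, 'p) rep \<Rightarrow> nat \<Rightarrow> 't \<Rightarrow> 'p) \<Rightarrow> bool"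
where
  "irreducible_decomposition \<tau> R proj \<longleftrightarrow>
     finite R \<and>
     (\<forall>\<rho>\<in>R. irreducible_rep \<rho> \<and> occurs_in \<rho> \<tau>) \<and>
     (\<forall>\<rho>\<in>R. \<forall>\<rho>'\<in>R. equivalent_reps \<rho> \<rho>' \<longrightarrow> \<rho> = \<rho>') \<and>
     (\<forall>\<rho>::('g, 'p) rep. irreducible_rep \<rho> \<and> occurs_in \<rho> \<tau> \<longrightarrow> (\<exists>\<rho>'\<in>R. equivalent_reps \<rho> \<rho>')) \<and>
     (\<forall>\<rho>\<in>R. \<forall>k\<in>{1..rep_multiplicity \<rho> \<tau>}. intertwiner \<tau> \<rho> (proj \<rho> k)) \<and>
     (\<forall>z\<in>vecs \<tau>. \<forall>z'\<in>vecs \<tau>.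
        inner_prod \<tau> z z' =
          (\<Sum>\<rho>\<in>R. \<Sum>k=1..rep_multiplicity \<rho> \<tau>. inner_prod \<rho> (proj \<rho> k z) (proj \<rho> k z'))) \<and>
     (\<forall>x. (\<forall>\<rho>\<in>R. \<forall>k\<in>{1..rep_multiplicity \<rho> \<tau>}. x \<rho> k \<in> vecs \<rho>) \<longrightarrow>
        (\<exists>z\<in>vecs \<tau>. \<forall>\<rho>\<in>R. \<forall>k\<in>{1..rep_multiplicity \<rho> \<tau>}. proj \<rho> k z = x \<rho> k))"

section \<open>Highest weights and Toeplitz operators\<close>

definition weight_vector ::
  "('g::topological_group_add, 'e::euclidean_space) lie_structure \<Rightarrow> 'g set
     \<Rightarrow> ('g, 'v::ab_group_add) rep \<Rightarrow> ('e \<Rightarrow> real) \<Rightarrow> 'v \<Rightarrow> bool"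
where
  "weight_vector G T \<sigma> \<mu> v \<longleftrightarrow>
     v \<in> vecs \<sigma> \<and> v \<noteq> 0 \<and>
     (\<forall>\<xi>\<in>lie_subalgebra G T. act \<sigma> (lie_exp G \<xi>) v = scale \<sigma> (cis (\<mu> \<xi>)) v)"

definition weights ::
  "('g::topological_group_add, 'e::euclidean_space) lie_structure \<Rightarrow> 'g set
     \<Rightarrow> ('g, 'v::ab_group_add) rep \<Rightarrow> ('e \<Rightarrow> real) set"
where
  "weights G T \<sigma> = {\<mu> \<in> functionals G T. \<exists>v. weight_vector G T \<sigma> \<mu> v}"

text \<open>
  \<open>\<mu>\<close> is a weight, and every weight arises from \<open>\<mu>\<close> by subtracting a sum of positive roots.
\<close>

definition highest_weight ::
  "('g::topological_group_add, 'e::euclidean_space) lie_structure \<Rightarrow> 'g set \<Rightarrow> ('e \<Rightarrow> real) set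
     \<Rightarrow> ('g, 'v::ab_group_add) rep \<Rightarrow> ('e \<Rightarrow> real) \<Rightarrow> bool"
where
  "highest_weight G T P \<sigma> \<mu> \<longleftrightarrow>
     \<mu> \<in> weights G T \<sigma> \<and>
     (\<forall>\<nu>\<in>weights G T \<sigma>. \<exists>n::('e \<Rightarrow> real) \<Rightarrow> nat.
        \<forall>\<xi>. \<mu> \<xi> = \<nu> \<xi> + (\<Sum>\<alpha>\<in>P. real (n \<alpha>) * \<alpha> \<xi>))"

definition line_stabilizer :: "('g, 'v) rep \<Rightarrow> 'v \<Rightarrow> 'g set" where
  "line_stabilizer \<sigma> v = {g. \<exists>c. act \<sigma> g v = scale \<sigma> c v}"

definition fixed_vectors :: "('g, 'v) rep \<Rightarrow> 'g set \<Rightarrow> 'v set" where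
  "fixed_vectors \<pi> L = {v \<in> vecs \<pi>. \<forall>l\<in>L. act \<pi> l v = v}"

text \<open>
  The symbol \<open>f\<close> is a (right-invariant) function on the group; \<open>v\<^sub>0\<close> is the vector generating the
  coherent states. The operator is determined by its sesquilinear form.
\<close>

definition toeplitz ::
  "'g measure \<Rightarrow> ('g, 'v::ab_group_add) rep \<Rightarrow> 'v \<Rightarrow> ('g \<Rightarrow> complex) \<Rightarrow> 'v \<Rightarrow> 'v"
where
  "toeplitz \<mu> \<sigma> v\<^sub>0 f v =
     (THE x. x \<in> vecs \<sigma> \<and>
        (\<forall>w\<in>vecs \<sigma>. inner_prod \<sigma> x w =
           of_nat (hdim \<sigma>) *
             (\<integral>y. f y * inner_prod \<sigma> v (act \<sigma> y v\<^sub>0) * cnj (inner_prod \<sigma> w (act \<sigma> y v\<^sub>0)) \<partial>\<mu>)))"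

end

theory Submission
  imports Defs "HOL-Computational_Algebra.Fundamental_Theorem_Algebra"
begin

text \<open>
  Since \<open>\<langle>v \<otimes> w, y (v\<^sub>\<lambda> \<otimes> v\<^sub>\<lambda>)\<rangle> = \<langle>v, y v\<^sub>\<lambda>\<rangle> \<langle>y v\<^sub>\<lambda>, w\<rangle>\<close> (second factors being conjugate), the integrand that
  defines the Toeplitz form is a matrix coefficient of the tensor product times a matrix coefficient
  of \<open>\<pi>\<close>. Decomposing the tensor product into irreducibles turns the integral into a sum of
  integrals to which Schur orthogonality applies; only the copies of \<open>\<pi>\<close> survive.

  Schur orthogonality needs left invariance only: for fixed \<open>b\<close> and \<open>v\<close>, the integral of
  \<open>\<langle>a, y b\<rangle> \<langle>y v, u\<rangle>\<close> is an invariant sesquilinear form in \<open>(a, u)\<close>, hence zero or a multiple of the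
  inner product, and the factor is found by summing over an orthonormal basis \<open>a = u = e\<close>.
\<close>

section \<open>Finite-dimensional Hilbert spaces and orthonormal bases\<close>

locale fd_hilbert_space =
  fixes H :: "('v::ab_group_add, 'z) hilbert_scheme"
  assumes fd_hilbert: "fd_hilbert H"
begin

sublocale vector_space "scale H"
  using fd_hilbert by (simp add: fd_hilbert_def)

lemma subspace_vecs: "subspace (vecs H)"
  using fd_hilbert by (simp add: fd_hilbert_def)

lemmas vecs_zero [simp] = subspace_0 [OF subspace_vecs]
lemmas vecs_add [simp, intro] = subspace_add [OF subspace_vecs]
lemmas vecs_diff [simp, intro] = subspace_diff [OF subspace_vecs]
lemmas vecs_scale [simp, intro] = subspace_scale [OF subspace_vecs]
lemmas vecs_sum [intro] = subspace_sum [OF subspace_vecs]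

lemma inner_prod_commute: "\<lbrakk>x \<in> vecs H; y \<in> vecs H\<rbrakk> \<Longrightarrow> inner_prod H y x = cnj (inner_prod H x y)"
  using fd_hilbert unfolding fd_hilbert_def by blast

lemma inner_prod_add_left:
  "\<lbrakk>x \<in> vecs H; y \<in> vecs H; z \<in> vecs H\<rbrakk>
     \<Longrightarrow> inner_prod H (x + y) z = inner_prod H x z + inner_prod H y z"
  using fd_hilbert unfolding fd_hilbert_def by blast

lemma inner_prod_scale_left:
  "\<lbrakk>x \<in> vecs H; y \<in> vecs H\<rbrakk> \<Longrightarrow> inner_prod H (scale H c x) y = c * inner_prod H x y"
  using fd_hilbert unfolding fd_hilbert_def by blast

lemma inner_prod_add_right:
  assumes "x \<in> vecs H" "y \<in> vecs H" "z \<in> vecs H"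
  shows "inner_prod H x (y + z) = inner_prod H x y + inner_prod H x z"
  using inner_prod_add_left[of y z x] assms
  by (metis inner_prod_commute complex_cnj_add vecs_add)

lemma inner_prod_scale_right:
  assumes "x \<in> vecs H" "y \<in> vecs H"
  shows "inner_prod H x (scale H c y) = cnj c * inner_prod H x y"
  using inner_prod_scale_left[of y x c] assms
  by (metis inner_prod_commute complex_cnj_mult vecs_scale)

lemma inner_prod_zero_left [simp]: "x \<in> vecs H \<Longrightarrow> inner_prod H 0 x = 0"
  using inner_prod_scale_left[of 0 x 0] by simp

lemma inner_prod_zero_right [simp]: "x \<in> vecs H \<Longrightarrow> inner_prod H x 0 = 0"
  using inner_prod_scale_right[of x 0 0] by simp

lemma inner_prod_diff_left:
  "\<lbrakk>x \<in> vecs H; y \<in> vecs H; z \<in> vecs H\<rbrakk>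
     \<Longrightarrow> inner_prod H (x - y) z = inner_prod H x z - inner_prod H y z"
  using inner_prod_add_left[of "x - y" y z] by simp

lemma inner_prod_diff_right:
  "\<lbrakk>x \<in> vecs H; y \<in> vecs H; z \<in> vecs H\<rbrakk>
     \<Longrightarrow> inner_prod H x (y - z) = inner_prod H x y - inner_prod H x z"
  using inner_prod_add_right[of x "y - z" z] by simp

lemma inner_prod_sum_left:
  assumes "\<And>i. i \<in> I \<Longrightarrow> f i \<in> vecs H" "y \<in> vecs H"
  shows "inner_prod H (\<Sum>i\<in>I. f i) y = (\<Sum>i\<in>I. inner_prod H (f i) y)"
  using assms
  by (induction I rule: infinite_finite_induct) (simp_all add: inner_prod_add_left vecs_sum)

lemma inner_prod_pos: "\<lbrakk>x \<in> vecs H; x \<noteq> 0\<rbrakk> \<Longrightarrow> 0 < Re (inner_prod H x x)"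
  using fd_hilbert unfolding fd_hilbert_def by blast

lemma inner_prod_self: 
  assumes "x \<in> vecs H" shows "inner_prod H x x = of_real ((hnorm H x)\<^sup>2)"
proof -
  have "Im (inner_prod H x x) = 0"
    using inner_prod_commute[OF assms assms] by (simp add: complex_eq_iff)
  moreover have "0 \<le> Re (inner_prod H x x)"
    using inner_prod_pos[OF assms] assms by (cases "x = 0") auto
  ultimately show ?thesis by (simp add: complex_eq_iff hnorm_def)
qed

lemma hnorm_nonneg [simp]: "x \<in> vecs H \<Longrightarrow> 0 \<le> hnorm H x"
  using inner_prod_pos[of x] by (cases "x = 0") (auto simp: hnorm_def)

lemma inner_prod_self_eq_0: "\<lbrakk>x \<in> vecs H; inner_prod H x x = 0\<rbrakk> \<Longrightarrow> x = 0"
  using inner_prod_pos by fastforce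

lemma inner_prod_eqI:
  assumes "x \<in> vecs H" "y \<in> vecs H" "\<And>z. z \<in> vecs H \<Longrightarrow> inner_prod H x z = inner_prod H y z"
  shows "x = y"
  using inner_prod_self_eq_0[of "x - y"] assms inner_prod_diff_left[of x y "x - y"] by auto

lemma Cauchy_Schwarz:
  assumes x: "x \<in> vecs H" and y: "y \<in> vecs H"
  shows "cmod (inner_prod H x y) \<le> hnorm H x * hnorm H y"
proof (cases "y = 0")
  case True
  then show ?thesis using x y by simp
next
  case False
  define n where "n = hnorm H y"
  define s where "s = inner_prod H x y"
  have n: "n > 0" using inner_prod_pos[OF y False] by (simp add: n_def hnorm_def)
  \<comment> \<open>\<open>z\<close> is \<open>n\<^sup>2\<close> times the component of
    \<open>x\<close> orthogonal to \<open>y\<close>. Multiplying by \<open>n\<^sup>2\<close> avoids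
    division, and the inequality is read off from the nonnegativity of its squared norm.\<close>
  define z where "z = scale H (of_real (n\<^sup>2)) x - scale H s y"
  have z: "z \<in> vecs H" using x y by (simp add: z_def)
  have yx: "inner_prod H y x = cnj s" using inner_prod_commute[OF x y] by (simp add: s_def)
  have "inner_prod H z z = of_real (n\<^sup>2) * (of_real (n\<^sup>2) * of_real ((hnorm H x)\<^sup>2) - cnj s * s)"
    using x y unfolding z_def
    by (simp add: inner_prod_diff_left inner_prod_diff_right inner_prod_scale_left
        inner_prod_scale_right inner_prod_self[OF x] inner_prod_self[OF y] yx
        s_def[symmetric] n_def[symmetric] algebra_simps)
  also have "\<dots> = of_real (n\<^sup>2 * (n\<^sup>2 * (hnorm H x)\<^sup>2 - (cmod s)\<^sup>2))"
    using complex_norm_square[of s] by (simp add: mult.commute[of "cnj s"])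
  finally have "0 \<le> n\<^sup>2 * (n\<^sup>2 * (hnorm H x)\<^sup>2 - (cmod s)\<^sup>2)"
    by (metis inner_prod_self[OF z] of_real_eq_iff zero_le_power2)
  then have "0 \<le> n\<^sup>2 * (hnorm H x)\<^sup>2 - (cmod s)\<^sup>2"
    using n by (meson mult_pos_neg not_le zero_less_power)
  then have "(cmod s)\<^sup>2 \<le> (hnorm H x * n)\<^sup>2"
    by (simp add: power_mult_distrib mult.commute[of "n\<^sup>2"])
  then have "cmod s \<le> hnorm H x * n"
    by (rule power2_le_imp_le) (use x n in simp)
  then show ?thesis by (simp add: s_def n_def)
qed

text \<open>Spanning is kept apart from orthonormality, so that \<open>Gram_Schmidt\<close> can grow
  orthonormal sets whose span is still too small.\<close>

definition orthonormal :: "'v set \<Rightarrow> bool" where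
  "orthonormal E \<longleftrightarrow> finite E \<and> E \<subseteq> vecs H \<and>
     (\<forall>a\<in>E. \<forall>b\<in>E. inner_prod H a b = (if a = b then 1 else 0))"

text \<open>The common core of \<open>orthonormal_expansion\<close> and \<open>Gram_Schmidt\<close>:
  what remains after subtracting the projection onto the span of \<open>E\<close> is orthogonal to
  \<open>E\<close>, whether or not \<open>E\<close> spans the space.\<close>

lemma inner_prod_residual:
  assumes E: "orthonormal E" and x: "x \<in> vecs H" and e: "e \<in> E"
  shows "inner_prod H (x - (\<Sum>a\<in>E. scale H (inner_prod H x a) a)) e = 0"
proof -
  have mem: "a \<in> vecs H" if "a \<in> E" for a using E that by (auto simp: orthonormal_def)
  have "inner_prod H (\<Sum>a\<in>E. scale H (inner_prod H x a) a) e
      = (\<Sum>a\<in>E. inner_prod H x a * inner_prod H a e)"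
    using mem e by (simp add: inner_prod_sum_left inner_prod_scale_left)
  also have "\<dots> = (\<Sum>a\<in>E. if a = e then inner_prod H x a else 0)"
    using E e by (intro sum.cong) (auto simp: orthonormal_def)
  also have "\<dots> = inner_prod H x e"
    using E e by (simp add: orthonormal_def)
  finally show ?thesis
    using mem e x by (subst inner_prod_diff_left) (auto intro: vecs_sum)
qed

text \<open>The residual \<open>y\<close> is orthogonal to \<open>E\<close>, hence to the span of
  \<open>E\<close>. That span contains \<open>y\<close> itself, so \<open>y\<close>
  vanishes.\<close>

lemma orthonormal_expansion:
  assumes E: "orthonormal E" "span E = vecs H" and x: "x \<in> vecs H"
  shows "x = (\<Sum>e\<in>E. scale H (inner_prod H x e) e)"
proof -
  define y where "y = x - (\<Sum>e\<in>E. scale H (inner_prod H x e) e)"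
  have y: "y \<in> vecs H"
    using E x unfolding y_def by (intro vecs_diff vecs_sum) (auto simp: orthonormal_def)
  have "z \<in> vecs H \<and> inner_prod H y z = 0" if "z \<in> span E" for z
    using that
  proof (induction rule: span_induct)
    case base
    show ?case using y
      by (simp add: subspace_def inner_prod_add_right inner_prod_scale_right)
  next
    case (step z)
    then show ?case using inner_prod_residual[OF E(1) x] E by (auto simp: y_def orthonormal_def)
  qed
  then have "y = 0" using y E inner_prod_self_eq_0 by metis
  then show ?thesis by (simp add: y_def)
qed

text \<open>The claim compares spans and not cardinalities, so \<open>B\<close> may be dependent: a
  new vector whose residual is zero is discarded, any other residual is normalized and
  added.\<close>

lemma Gram_Schmidt:
  assumes "finite B" "B \<subseteq> vecs H"
  shows "\<exists>E. orthonormal E \<and> span E = span B"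
  using assms
proof (induction B rule: finite_induct)
  case empty
  show ?case by (intro exI[of _ "{}"]) (simp add: orthonormal_def)
next
  case (insert b B)
  then obtain E where E: "orthonormal E" "span E = span B" by auto
  have b: "b \<in> vecs H" using insert.prems by simp
  have mem: "a \<in> vecs H" if "a \<in> E" for a using E that by (auto simp: orthonormal_def)
  define s where "s = (\<Sum>e\<in>E. scale H (inner_prod H b e) e)"
  define y where "y = b - s"
  have s: "s \<in> span E"
    unfolding s_def by (intro span_sum span_scale span_base)
  have y: "y \<in> vecs H"
    using b mem unfolding y_def s_def by (auto intro: vecs_sum)
  have ye: "inner_prod H y e = 0" if "e \<in> E" for e
    using inner_prod_residual[OF E(1) b that] by (simp add: y_def s_def)
  show ?case
  proof (cases "y = 0")
    case True
    then have "b \<in> span B" using s E by (simp add: y_def)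
    then show ?thesis using E by (metis span_redundant)
  next
    case False
    define r where "r = hnorm H y"
    have r: "r > 0" using inner_prod_pos[OF y False] by (simp add: r_def hnorm_def)
    define n where "n = scale H (of_real (inverse r)) y"
    have n: "n \<in> vecs H" using y by (simp add: n_def)
    have nn: "inner_prod H n n = 1"
      using y r inner_prod_self[OF y]
      by (simp add: n_def inner_prod_scale_left inner_prod_scale_right r_def[symmetric]
          power2_eq_square field_simps)
    have ne: "inner_prod H n e = 0 \<and> inner_prod H e n = 0" if "e \<in> E" for e
      using ye[OF that] mem[OF that] y inner_prod_commute[OF y mem[OF that]]
      by (simp add: n_def inner_prod_scale_left inner_prod_scale_right)
    have "orthonormal (insert n E)"
      using E n nn ne unfolding orthonormal_def by auto
    moreover have "span (insert n E) = span (insert b B)"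
    proof -
      \<comment> \<open>\<open>b\<close> is a nonzero multiple of \<open>n\<close> plus the element
        \<open>s\<close> of the span of \<open>E\<close>, so \<open>b\<close> and \<open>n\<close>
        can be exchanged.\<close>
      have yn: "y = scale H (of_real r) n"
        using r by (simp add: n_def)
      have "n \<in> span (insert b E)"
        unfolding n_def y_def using s span_mono[OF subset_insertI, of E b]
        by (blast intro: span_scale span_diff span_base)
      moreover have "b = scale H (of_real r) n + s"
        using yn unfolding y_def by (metis diff_add_cancel)
      then have "b \<in> span (insert n E)"
        using s span_mono[OF subset_insertI, of E n]
        by (simp only:) (blast intro: span_add span_base span_scale)
      ultimately have "span (insert n E) = span (insert b E)"
        by (meson insert_subset span_eq span_superset subset_insertI subset_trans)
      also have "\<dots> = span (insert b B)"
        using E(2) by (simp add: span_insert)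
      finally show ?thesis .
    qed
    ultimately show ?thesis by blast
  qed
qed

lemma orthonormal_basis:
  obtains E where "orthonormal E" "span E = vecs H" "card E = hdim H"
proof -
  obtain B where B: "finite B" "vecs H = span B"
    using fd_hilbert by (auto simp: fd_hilbert_def)
  then obtain E where E: "orthonormal E" "span E = vecs H"
    using Gram_Schmidt[of B] span_superset by metis
  \<comment> \<open>Pairing a vanishing linear combination with \<open>e\<close> isolates the
    coefficient of \<open>e\<close>.\<close>
  have "independent E"
  proof (rule independent_if_scalars_zero)
    show "finite E" using E by (simp add: orthonormal_def)
    fix f e assume z: "(\<Sum>x\<in>E. scale H (f x) x) = 0" and e: "e \<in> E"
    have mem: "a \<in> vecs H" if "a \<in> E" for a using E that by (auto simp: orthonormal_def)
    have "0 = inner_prod H (\<Sum>x\<in>E. scale H (f x) x) e"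
      using z e mem by simp
    also have "\<dots> = (\<Sum>x\<in>E. f x * inner_prod H x e)"
      using mem e by (simp add: inner_prod_sum_left inner_prod_scale_left)
    also have "\<dots> = (\<Sum>x\<in>E. if x = e then f x else 0)"
      using E e by (intro sum.cong) (auto simp: orthonormal_def)
    also have "\<dots> = f e" using E e by (simp add: orthonormal_def)
    finally show "f e = 0" by simp
  qed
  then have "hdim H = card E"
    unfolding hdim_def using E(2) by (metis dim_span_eq_card_independent)
  then show ?thesis using that E by simp
qed

lemma Parseval:
  assumes E: "orthonormal E" "span E = vecs H" and x: "x \<in> vecs H" and y: "y \<in> vecs H"
  shows "inner_prod H x y = (\<Sum>e\<in>E. inner_prod H x e * inner_prod H e y)"
proof -
  have mem: "a \<in> vecs H" if "a \<in> E" for a using E that by (auto simp: orthonormal_def)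
  have "inner_prod H x y = inner_prod H (\<Sum>e\<in>E. scale H (inner_prod H x e) e) y"
    using orthonormal_expansion[OF E x] by simp
  also have "\<dots> = (\<Sum>e\<in>E. inner_prod H x e * inner_prod H e y)"
    using mem y by (simp add: inner_prod_sum_left inner_prod_scale_left)
  finally show ?thesis .
qed

section \<open>Existence of eigenvectors\<close>

lemma hlinear_zero: "hlinear H H A \<Longrightarrow> A 0 = 0"
  unfolding hlinear_def by (metis add_cancel_right_right vecs_zero)

lemma exists_eigenvector:
  assumes A: "hlinear H H A" and nontrivial: "vecs H \<noteq> {0}"
  obtains c x where "x \<in> vecs H" "x \<noteq> 0" "A x = scale H c x"
proof -
  have A_vecs: "x \<in> vecs H \<Longrightarrow> A x \<in> vecs H"
    and A_add: "\<lbrakk>x \<in> vecs H; y \<in> vecs H\<rbrakk> \<Longrightarrow> A (x + y) = A x + A y"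
    and A_scale: "x \<in> vecs H \<Longrightarrow> A (scale H c x) = scale H c (A x)" for x y c
    using A by (auto simp: hlinear_def)
  \<comment> \<open>With \<open>Q p = p(A) v\<close> and \<open>m \<noteq> 0\<close> of least degree such that \<open>Q m = 0\<close>: if \<open>m = (X - c) q\<close>, then \<open>Q q\<close> is
    an eigenvector.\<close>
  obtain v where v: "v \<in> vecs H" "v \<noteq> 0" using nontrivial vecs_zero by blast
  \<comment> \<open>Horner's scheme: each coefficient costs one application of \<open>A\<close>, so
    no powers of \<open>A\<close> have to be formed.\<close>
  define Q where "Q p = fold_coeffs (\<lambda>a x. scale H a v + A x) p 0" for p
  have Q_0 [simp]: "Q 0 = 0" by (simp add: Q_def)
  have Q_pCons [simp]: "Q (pCons a p) = scale H a v + A (Q p)" for a p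
    by (cases "a = 0 \<and> p = 0") (auto simp: Q_def hlinear_zero[OF A])
  have Q_vecs: "Q p \<in> vecs H" for p
    by (induction p) (auto simp: v A_vecs)
  have Q_add: "Q (p + q) = Q p + Q q" for p q
    by (induction p q rule: poly_induct2) (auto simp: Q_vecs A_add scale_left_distrib algebra_simps)
  have Q_smult: "Q (smult c p) = scale H c (Q p)" for c p
    by (induction p) (auto simp: Q_vecs A_scale scale_right_distrib)
  have Q_sum: "Q (\<Sum>i\<in>I. p i) = (\<Sum>i\<in>I. Q (p i))" if "finite I" for p :: "nat \<Rightarrow> complex poly" and I
    using that by (induction I rule: finite_induct) (auto simp: Q_add)
  define X where "X i = Q (monom 1 i)" for i
  have Q_monom: "Q (monom c i) = scale H c (X i)" for c i
    unfolding X_def by (metis Q_smult mult.right_neutral smult_monom)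
  \<comment> \<open>Some nonzero polynomial annihilates \<open>v\<close>, by finite dimension.
    Linear dependence is a property of sets, so repetitions among the iterates \<open>X i\<close>
    are treated first: \<open>X i = X j\<close> gives a difference of two monomials, and otherwise
    the iterates are distinct and a dependent set of them supplies the coefficients.\<close>
  obtain p where p: "p \<noteq> 0" "Q p = 0"
  proof (cases "inj X")
    case False
    then obtain i j where ij: "i \<noteq> j" "X i = X j" by (auto simp: inj_def)
    have "Q (monom 1 i + monom (- 1) j) = 0"
      using ij by (simp add: Q_add Q_monom)
    moreover have "coeff (monom (1::complex) i + monom (- 1) j) i \<noteq> 0"
      using ij by simp
    then have "monom (1::complex) i + monom (- 1) j \<noteq> 0" by force
    ultimately show ?thesis using that by blast
  next
    case True
    obtain B where B: "finite B" "vecs H = span B"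
      using fd_hilbert by (auto simp: fd_hilbert_def)
    \<comment> \<open>These are \<open>card B + 1\<close> indices, one more than a set spanned by
      \<open>B\<close> can have independent vectors.\<close>
    define I where "I = {..card B}"
    have inj: "inj_on X I" using True inj_on_subset by blast
    have "dependent (X ` I)"
    proof (rule ccontr)
      assume "independent (X ` I)"
      moreover have "X ` I \<subseteq> span B" using B Q_vecs by (auto simp: X_def)
      ultimately have "card (X ` I) \<le> card B" using independent_span_bound[OF B(1)] by blast
      then show False using inj by (simp add: card_image I_def)
    qed
    then obtain f i where f: "i \<in> I" "f (X i) \<noteq> 0" "(\<Sum>x\<in>X ` I. scale H (f x) x) = 0"
      by (subst (asm) dependent_finite) (auto simp: I_def)
    define p where "p = (\<Sum>j\<in>I. monom (f (X j)) j)"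
    have "Q p = 0"
      using f(3) inj by (simp add: p_def Q_sum I_def Q_monom sum.reindex)
    moreover have "coeff p i = f (X i)"
      using f(1) by (simp add: p_def coeff_sum I_def)
    then have "p \<noteq> 0" using f(2) by force
    ultimately show ?thesis using that by blast
  qed
  obtain m where m: "m \<noteq> 0 \<and> Q m = 0" and min: "\<And>q. q \<noteq> 0 \<and> Q q = 0 \<Longrightarrow> degree m \<le> degree q"
    using ex_has_least_nat[of "\<lambda>q. q \<noteq> 0 \<and> Q q = 0" p degree] p by blast
  \<comment> \<open>A nonzero constant \<open>a\<close> cannot annihilate \<open>v\<close>, because
    \<open>Q\<close> sends it to \<open>a\<close> times \<open>v\<close>.\<close>
  have "degree m \<noteq> 0"
  proof
    assume "degree m = 0"
    then obtain a where "m = [:a:]" by (elim degree_eq_zeroE)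
    then show False using m v by (simp add: hlinear_zero[OF A])
  qed
  then have "\<not> constant (poly m)" by (simp add: constant_degree)
  then obtain c where "poly m c = 0"
    using fundamental_theorem_of_algebra by blast
  then have "[:- c, 1:] dvd m" by (simp add: poly_eq_0_iff_dvd)
  then obtain q where q: "m = [:- c, 1:] * q" by (elim dvdE)
  then have "q \<noteq> 0" using m by auto
  then have "degree m = Suc (degree q)" unfolding q by (subst degree_mult_eq) auto
  then have "Q q \<noteq> 0" using min[of q] \<open>q \<noteq> 0\<close> by auto
  \<comment> \<open>\<open>pCons 0 q\<close> is \<open>q\<close> times the variable, which
    \<open>Q\<close> turns into an application of \<open>A\<close>.\<close>
  moreover have "m = smult (- c) q + pCons 0 q" by (simp add: q)
  then have "Q m = A (Q q) - scale H c (Q q)"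
    by (simp only: Q_add Q_smult Q_pCons) simp
  then have "A (Q q) = scale H c (Q q)" using m by simp
  ultimately show ?thesis using that[of "Q q" c] Q_vecs by simp
qed

end

section \<open>Sesquilinear forms and the operators representing them\<close>

definition sesquilinear ::
  "('v::ab_group_add, 'y) hilbert_scheme \<Rightarrow> ('w::ab_group_add, 'z) hilbert_scheme
     \<Rightarrow> ('v \<Rightarrow> 'w \<Rightarrow> complex) \<Rightarrow> bool"
where
  "sesquilinear H K Q \<longleftrightarrow>
     (\<forall>x\<in>vecs H. \<forall>x'\<in>vecs H. \<forall>y\<in>vecs K. Q (x + x') y = Q x y + Q x' y) \<and>
     (\<forall>c. \<forall>x\<in>vecs H. \<forall>y\<in>vecs K. Q (scale H c x) y = c * Q x y) \<and>
     (\<forall>x\<in>vecs H. \<forall>y\<in>vecs K. \<forall>y'\<in>vecs K. Q x (y + y') = Q x y + Q x y') \<and>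
     (\<forall>c. \<forall>x\<in>vecs H. \<forall>y\<in>vecs K. Q x (scale K c y) = cnj c * Q x y)"

text \<open>Riesz representation in coordinates: on an orthonormal basis of \<open>K\<close> the
  coordinate of \<open>A x\<close> at \<open>e\<close> has to be \<open>Q x e\<close>, which
  dictates \<open>A\<close>. Both Schur's lemma and the existence of Toeplitz operators rest on
  this.\<close>

lemma sesquilinear_representation:
  assumes H: "fd_hilbert H" and K: "fd_hilbert K" and Q: "sesquilinear H K Q"
  obtains A where "hlinear H K A"
    "\<And>x y. \<lbrakk>x \<in> vecs H; y \<in> vecs K\<rbrakk> \<Longrightarrow> Q x y = inner_prod K (A x) y"
proof -
  interpret H: fd_hilbert_space H by (simp add: fd_hilbert_space_def H)
  interpret K: fd_hilbert_space K by (simp add: fd_hilbert_space_def K)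
  obtain E where E: "K.orthonormal E" "K.span E = vecs K" using K.orthonormal_basis by blast
  have mem: "a \<in> vecs K" if "a \<in> E" for a using E that by (auto simp: K.orthonormal_def)
  define A where "A x = (\<Sum>e\<in>E. scale K (Q x e) e)" for x
  have A: "hlinear H K A"
    using Q mem unfolding hlinear_def A_def sesquilinear_def
    by (auto intro!: K.vecs_sum simp: K.scale_left_distrib sum.distrib K.scale_sum_right)
  moreover have "Q x y = inner_prod K (A x) y" if x: "x \<in> vecs H" and y: "y \<in> vecs K" for x y
  proof -
    have Q0: "Q x 0 = 0"
      using Q x K.vecs_zero unfolding sesquilinear_def by (metis add_cancel_right_right)
    have Qsum: "Q x (\<Sum>i\<in>I. f i) = (\<Sum>i\<in>I. Q x (f i))" if "\<And>i. i \<in> I \<Longrightarrow> f i \<in> vecs K" for I f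
      using that Q x by (induction I rule: infinite_finite_induct)
        (auto simp: Q0 sesquilinear_def K.vecs_sum)
    have "Q x y = Q x (\<Sum>e\<in>E. scale K (inner_prod K y e) e)"
      using K.orthonormal_expansion[OF E y] by simp
    also have "\<dots> = (\<Sum>e\<in>E. cnj (inner_prod K y e) * Q x e)"
      using Q x mem by (subst Qsum) (auto simp: sesquilinear_def)
    also have "\<dots> = (\<Sum>e\<in>E. Q x e * inner_prod K e y)"
      using K.inner_prod_commute[OF y mem] by (intro sum.cong) auto
    also have "\<dots> = inner_prod K (A x) y"
      using mem y by (simp add: A_def K.inner_prod_sum_left K.inner_prod_scale_left)
    finally show ?thesis .
  qed
  ultimately show ?thesis using that by blast
qed

text \<open>At each fixed group element the integrands below have this shape, \<open>p\<close> and
  \<open>q\<close> being translated vectors and \<open>c\<close> the value of a scalar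
  factor.\<close>

lemma sesquilinear_rank_one:
  assumes "fd_hilbert H" "fd_hilbert K" "p \<in> vecs H" "q \<in> vecs K"
  shows "sesquilinear H K (\<lambda>x y. c * (inner_prod H x p * inner_prod K q y))"
proof -
  interpret H: fd_hilbert_space H by (simp add: fd_hilbert_space_def assms)
  interpret K: fd_hilbert_space K by (simp add: fd_hilbert_space_def assms)
  show ?thesis
    using assms by (simp add: sesquilinear_def H.inner_prod_add_left H.inner_prod_scale_left
        K.inner_prod_add_right K.inner_prod_scale_right algebra_simps)
qed

lemma sesquilinear_integral:
  assumes "fd_hilbert H" "fd_hilbert K" "\<And>t. sesquilinear H K (Q t)"
    and "\<And>x y. \<lbrakk>x \<in> vecs H; y \<in> vecs K\<rbrakk> \<Longrightarrow> integrable M (\<lambda>t. Q t x y)"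
  shows "sesquilinear H K (\<lambda>x y. \<integral>t. Q t x y \<partial>M)"
proof -
  interpret H: fd_hilbert_space H by (simp add: fd_hilbert_space_def assms)
  interpret K: fd_hilbert_space K by (simp add: fd_hilbert_space_def assms)
  show ?thesis
    using assms(3,4) by (simp add: sesquilinear_def)
qed

section \<open>Unitary representations and their matrix coefficients\<close>

locale unitary_representation =
  fixes \<sigma> :: "('g::topological_group_add, 'v::ab_group_add) rep"
  assumes unitary_rep: "unitary_rep \<sigma>"
begin

sublocale fd_hilbert_space \<sigma>
  using unitary_rep by (simp add: fd_hilbert_space_def unitary_rep_def)

lemma act_hlinear: "hlinear \<sigma> \<sigma> (act \<sigma> g)"
  using unitary_rep by (simp add: unitary_rep_def)

lemma act_vecs [simp, intro]: "x \<in> vecs \<sigma> \<Longrightarrow> act \<sigma> g x \<in> vecs \<sigma>"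
  using act_hlinear by (simp add: hlinear_def)

lemma act_scale: "x \<in> vecs \<sigma> \<Longrightarrow> act \<sigma> g (scale \<sigma> c x) = scale \<sigma> c (act \<sigma> g x)"
  using act_hlinear by (simp add: hlinear_def)

lemma act_plus: "x \<in> vecs \<sigma> \<Longrightarrow> act \<sigma> (g + h) x = act \<sigma> g (act \<sigma> h x)"
  using unitary_rep by (simp add: unitary_rep_def)

lemma act_minus_act [simp]: "x \<in> vecs \<sigma> \<Longrightarrow> act \<sigma> (- g) (act \<sigma> g x) = x"
  and act_act_minus [simp]: "x \<in> vecs \<sigma> \<Longrightarrow> act \<sigma> g (act \<sigma> (- g) x) = x"
  using unitary_rep by (simp_all flip: act_plus add: unitary_rep_def)

lemma inner_prod_act [simp]:
  "\<lbrakk>x \<in> vecs \<sigma>; y \<in> vecs \<sigma>\<rbrakk> \<Longrightarrow> inner_prod \<sigma> (act \<sigma> g x) (act \<sigma> g y) = inner_prod \<sigma> x y"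
  using unitary_rep by (simp add: unitary_rep_def)

lemma inner_prod_act_minus:
  assumes "x \<in> vecs \<sigma>" "y \<in> vecs \<sigma>"
  shows "inner_prod \<sigma> (act \<sigma> (- g) x) y = inner_prod \<sigma> x (act \<sigma> g y)"
  using inner_prod_act[of "act \<sigma> (- g) x" y g] assms by simp

lemma inner_prod_act_minus':
  assumes "x \<in> vecs \<sigma>" "y \<in> vecs \<sigma>"
  shows "inner_prod \<sigma> x (act \<sigma> (- g) y) = inner_prod \<sigma> (act \<sigma> g x) y"
  using inner_prod_act[of x "act \<sigma> (- g) y" g] assms by simp

text \<open>Pairing with the fixed vector \<open>y\<close> is Lipschitz by Cauchy-Schwarz, so
  continuity of the orbit map in norm passes to the coefficient.\<close>

lemma continuous_matrix_coeff:
  fixes x y :: 'v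
  assumes x: "x \<in> vecs \<sigma>" and y: "y \<in> vecs \<sigma>"
  shows "continuous_on UNIV (\<lambda>g. inner_prod \<sigma> (act \<sigma> g x) y)"
  unfolding continuous_on_def
proof
  fix g
  have "((\<lambda>h. hnorm \<sigma> (act \<sigma> h x - act \<sigma> g x) * hnorm \<sigma> y) \<longlongrightarrow> 0) (at g)"
    using unitary_rep x by (intro tendsto_mult_left_zero) (simp add: unitary_rep_def)
  moreover have "\<forall>\<^sub>F h in at g. cmod (inner_prod \<sigma> (act \<sigma> h x) y - inner_prod \<sigma> (act \<sigma> g x) y)
      \<le> hnorm \<sigma> (act \<sigma> h x - act \<sigma> g x) * hnorm \<sigma> y"
  proof (intro always_eventually allI)
    fix h
    show "cmod (inner_prod \<sigma> (act \<sigma> h x) y - inner_prod \<sigma> (act \<sigma> g x) y)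
        \<le> hnorm \<sigma> (act \<sigma> h x - act \<sigma> g x) * hnorm \<sigma> y"
      using Cauchy_Schwarz[of "act \<sigma> h x - act \<sigma> g x" y] x y by (simp add: inner_prod_diff_left)
  qed
  ultimately show "((\<lambda>g. inner_prod \<sigma> (act \<sigma> g x) y) \<longlongrightarrow> inner_prod \<sigma> (act \<sigma> g x) y) (at g within UNIV)"
    by - (rule LIM_zero_cancel, rule Lim_null_comparison)
qed

lemma continuous_matrix_coeff':
  assumes "x \<in> vecs \<sigma>" "y \<in> vecs \<sigma>"
  shows "continuous_on UNIV (\<lambda>g. inner_prod \<sigma> y (act \<sigma> g x))"
  using continuous_on_cnj[OF continuous_matrix_coeff[OF assms]] assms
  by (simp flip: inner_prod_commute)

end

section \<open>Invariant forms and Schur's lemma\<close>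

text \<open>Integration over the group produces forms rather than operators; Schur's lemma is
  therefore stated for forms, which stand for intertwiners from \<open>\<sigma>\<close> to
  \<open>\<tau>\<close>.\<close>

definition invariant_form ::
  "('g::topological_group_add, 'v::ab_group_add) rep \<Rightarrow> ('g, 'w::ab_group_add) rep
     \<Rightarrow> ('v \<Rightarrow> 'w \<Rightarrow> complex) \<Rightarrow> bool"
where
  "invariant_form \<sigma> \<tau> Q \<longleftrightarrow> sesquilinear \<sigma> \<tau> Q \<and>
     (\<forall>g. \<forall>x\<in>vecs \<sigma>. \<forall>y\<in>vecs \<tau>. Q (act \<sigma> g x) (act \<tau> g y) = Q x y)"

text \<open>The representing operator inherits equivariance: testing
  \<open>A (act \<sigma> g x)\<close> against \<open>z\<close>, written as \<open>g\<close> applied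
  to \<open>- g\<close> applied to \<open>z\<close>, lets invariance cancel \<open>g\<close>, and
  unitarity moves \<open>- g\<close> back as \<open>g\<close>.\<close>

lemma invariant_form_intertwiner:
  assumes \<sigma>: "unitary_rep \<sigma>" and \<tau>: "unitary_rep \<tau>" and Q: "invariant_form \<sigma> \<tau> Q"
  obtains A where "intertwiner \<sigma> \<tau> A"
    "\<And>x y. \<lbrakk>x \<in> vecs \<sigma>; y \<in> vecs \<tau>\<rbrakk> \<Longrightarrow> Q x y = inner_prod \<tau> (A x) y"
proof -
  interpret S: unitary_representation \<sigma> by (simp add: unitary_representation_def \<sigma>)
  interpret T: unitary_representation \<tau> by (simp add: unitary_representation_def \<tau>)
  obtain A where A: "hlinear \<sigma> \<tau> A"
      "\<And>x y. \<lbrakk>x \<in> vecs \<sigma>; y \<in> vecs \<tau>\<rbrakk> \<Longrightarrow> Q x y = inner_prod \<tau> (A x) y"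
    using sesquilinear_representation[OF S.fd_hilbert T.fd_hilbert] Q
    by (metis invariant_form_def)
  have A_vecs [simp]: "x \<in> vecs \<sigma> \<Longrightarrow> A x \<in> vecs \<tau>" for x using A by (simp add: hlinear_def)
  have "A (act \<sigma> g x) = act \<tau> g (A x)" if x: "x \<in> vecs \<sigma>" for g x
  proof (rule T.inner_prod_eqI)
    fix z assume z: "z \<in> vecs \<tau>"
    have "inner_prod \<tau> (A (act \<sigma> g x)) z = Q (act \<sigma> g x) (act \<tau> g (act \<tau> (- g) z))"
      using x z A(2) by simp
    also have "\<dots> = Q x (act \<tau> (- g) z)"
      using Q x z unfolding invariant_form_def by blast
    also have "\<dots> = inner_prod \<tau> (act \<tau> g (A x)) z"
      using x z A(2) by (simp add: T.inner_prod_act_minus')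
    finally show "inner_prod \<tau> (A (act \<sigma> g x)) z = inner_prod \<tau> (act \<tau> g (A x)) z" .
  qed (use x in auto)
  then show ?thesis
    using A by (intro that[of A]) (auto simp: intertwiner_def)
qed

text \<open>The representing intertwiner has an eigenvector, and its eigenspace \<open>W\<close> is
  invariant and nonzero. Irreducibility makes \<open>W\<close> the whole space, so the intertwiner
  is a scalar.\<close>

lemma Schur_invariant_form:
  assumes \<sigma>: "irreducible_rep \<sigma>" and Q: "invariant_form \<sigma> \<sigma> Q"
  obtains c where "\<And>x y. \<lbrakk>x \<in> vecs \<sigma>; y \<in> vecs \<sigma>\<rbrakk> \<Longrightarrow> Q x y = c * inner_prod \<sigma> x y"
proof -
  interpret S: unitary_representation \<sigma>
    using \<sigma> by (simp add: unitary_representation_def irreducible_rep_def)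
  obtain A where A: "intertwiner \<sigma> \<sigma> A"
    "\<And>x y. \<lbrakk>x \<in> vecs \<sigma>; y \<in> vecs \<sigma>\<rbrakk> \<Longrightarrow> Q x y = inner_prod \<sigma> (A x) y"
    using invariant_form_intertwiner[OF S.unitary_rep S.unitary_rep Q] by blast
  then have lin: "hlinear \<sigma> \<sigma> A" by (simp add: intertwiner_def)
  obtain c x where c: "x \<in> vecs \<sigma>" "x \<noteq> 0" "A x = scale \<sigma> c x"
    using S.exists_eigenvector[OF lin] \<sigma> unfolding irreducible_rep_def by metis
  define W where "W = {y \<in> vecs \<sigma>. A y = scale \<sigma> c y}"
  have "S.subspace W"
    using lin S.hlinear_zero[OF lin] unfolding S.subspace_def W_def hlinear_def
    by (auto simp: S.scale_right_distrib S.scale_left_commute)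
  moreover have "act \<sigma> g y \<in> W" if "y \<in> W" for g y
    using that A(1) by (auto simp: W_def intertwiner_def S.act_scale)
  moreover have "W \<subseteq> vecs \<sigma>" "W \<noteq> {0}" using c by (auto simp: W_def)
  ultimately have "W = vecs \<sigma>"
    using \<sigma> unfolding irreducible_rep_def by blast
  then have "Q y z = c * inner_prod \<sigma> y z" if "y \<in> vecs \<sigma>" "z \<in> vecs \<sigma>" for y z
    using that A(2) by (metis (mono_tags, lifting) S.inner_prod_scale_left W_def mem_Collect_eq)
  then show ?thesis using that by blast
qed

lemma Schur_inequivalent:
  assumes \<sigma>: "irreducible_rep \<sigma>" and \<tau>: "irreducible_rep \<tau>" and Q: "invariant_form \<sigma> \<tau> Q"
    and ineq: "\<not> equivalent_reps \<sigma> \<tau>" and x: "x \<in> vecs \<sigma>" and y: "y \<in> vecs \<tau>"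
  shows "Q x y = 0"
proof (rule ccontr)
  assume nz: "Q x y \<noteq> 0"
  interpret S: unitary_representation \<sigma>
    using \<sigma> by (simp add: unitary_representation_def irreducible_rep_def)
  interpret T: unitary_representation \<tau>
    using \<tau> by (simp add: unitary_representation_def irreducible_rep_def)
  obtain A where A: "intertwiner \<sigma> \<tau> A"
    "\<And>x y. \<lbrakk>x \<in> vecs \<sigma>; y \<in> vecs \<tau>\<rbrakk> \<Longrightarrow> Q x y = inner_prod \<tau> (A x) y"
    using invariant_form_intertwiner[OF S.unitary_rep T.unitary_rep Q] by blast
  have A_vecs [simp]: "z \<in> vecs \<sigma> \<Longrightarrow> A z \<in> vecs \<tau>"
    and A_add: "\<lbrakk>z \<in> vecs \<sigma>; z' \<in> vecs \<sigma>\<rbrakk> \<Longrightarrow> A (z + z') = A z + A z'"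
    and A_scale: "z \<in> vecs \<sigma> \<Longrightarrow> A (scale \<sigma> c z) = scale \<tau> c (A z)"
    and A_act: "z \<in> vecs \<sigma> \<Longrightarrow> A (act \<sigma> g z) = act \<tau> g (A z)" for z z' c g
    using A(1) by (auto simp: intertwiner_def hlinear_def)
  have Ax: "A x \<noteq> 0" using nz A(2)[OF x y] y by auto
  \<comment> \<open>The pulled back inner product is a multiple of that of \<open>\<sigma>\<close>, so \<open>A\<close> is an isometry up to scaling.\<close>
  have "invariant_form \<sigma> \<sigma> (\<lambda>z z'. inner_prod \<tau> (A z) (A z'))"
    by (simp add: invariant_form_def sesquilinear_def A_add A_scale A_act T.inner_prod_add_left
        T.inner_prod_add_right T.inner_prod_scale_left T.inner_prod_scale_right)
  then obtain c where c: "\<And>z z'. \<lbrakk>z \<in> vecs \<sigma>; z' \<in> vecs \<sigma>\<rbrakk>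
      \<Longrightarrow> inner_prod \<tau> (A z) (A z') = c * inner_prod \<sigma> z z'"
    using Schur_invariant_form[OF \<sigma>] by metis
  \<comment> \<open>The factor \<open>c\<close> is identified at the single vector \<open>x\<close>,
    where \<open>A x\<close> is nonzero: it equals the positive number \<open>r\<^sup>2\<close>, so
    dividing \<open>A\<close> by \<open>r\<close> gives an isometry.\<close>
  define r where "r = hnorm \<tau> (A x) / hnorm \<sigma> x"
  have Ax_pos: "0 < hnorm \<tau> (A x)"
    using T.inner_prod_pos[OF A_vecs[OF x] Ax] by (simp add: hnorm_def)
  have "x \<noteq> 0" using Ax x A_scale[OF x, of 0] by auto
  then have x_pos: "0 < hnorm \<sigma> x"
    using S.inner_prod_pos[OF x] by (simp add: hnorm_def)
  have r: "r > 0" using Ax_pos x_pos by (simp add: r_def)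
  have "c = of_real (r\<^sup>2)"
    using c[OF x x] x_pos
    by (simp add: S.inner_prod_self[OF x] T.inner_prod_self[OF A_vecs[OF x]] r_def power_divide
        field_simps)
  then have "isometric_intertwiner \<sigma> \<tau> (\<lambda>z. scale \<tau> (of_real (inverse r)) (A z))"
    using r by (simp add: isometric_intertwiner_def intertwiner_def hlinear_def A_add A_scale
        A_act T.act_scale T.scale_right_distrib T.scale_left_commute[of _ "of_real _"] c
        T.inner_prod_scale_left T.inner_prod_scale_right power2_eq_square field_simps)
  \<comment> \<open>Equivalence also requires surjectivity. The image is an invariant subspace
    containing a nonzero vector, so irreducibility of \<open>\<tau>\<close> makes it
    everything.\<close>
  moreover have "(\<lambda>z. scale \<tau> (of_real (inverse r)) (A z)) ` vecs \<sigma> = vecs \<tau>" (is "?f ` _ = _")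
  proof -
    have "T.subspace (?f ` vecs \<sigma>)"
      unfolding T.subspace_def
    proof (intro conjI ballI allI)
      show "0 \<in> ?f ` vecs \<sigma>"
        using A_scale[OF x, of 0] by (intro image_eqI[of _ _ 0]) auto
    next
      fix a b assume "a \<in> ?f ` vecs \<sigma>" "b \<in> ?f ` vecs \<sigma>"
      then obtain z z' where "z \<in> vecs \<sigma>" "z' \<in> vecs \<sigma>" "a = ?f z" "b = ?f z'" by blast
      then show "a + b \<in> ?f ` vecs \<sigma>"
        by (intro image_eqI[of _ _ "z + z'"]) (auto simp: A_add T.scale_right_distrib)
    next
      fix d a assume "a \<in> ?f ` vecs \<sigma>"
      then obtain z where "z \<in> vecs \<sigma>" "a = ?f z" by blast
      then show "scale \<tau> d a \<in> ?f ` vecs \<sigma>"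
        by (intro image_eqI[of _ _ "scale \<sigma> d z"]) (auto simp: A_scale mult.commute)
    qed
    moreover have "act \<tau> g a \<in> ?f ` vecs \<sigma>" if a: "a \<in> ?f ` vecs \<sigma>" for g a
    proof -
      obtain z where "z \<in> vecs \<sigma>" "a = ?f z" using a by blast
      then show ?thesis
        by (intro image_eqI[of _ _ "act \<sigma> g z"]) (auto simp: A_act T.act_scale)
    qed
    moreover have "?f ` vecs \<sigma> \<subseteq> vecs \<tau>" by auto
    moreover have "?f x \<in> ?f ` vecs \<sigma>" "?f x \<noteq> 0" using x Ax r by auto
    ultimately show ?thesis
      using \<tau> unfolding irreducible_rep_def by blast
  qed
  ultimately show False
    using ineq unfolding equivalent_reps_def by blast
qed

section \<open>Haar integration and Schur orthogonality\<close>

text \<open>Compactness bounds a continuous function, and a bounded measurable function is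
  integrable for a finite measure. This covers all products of matrix coefficients below.\<close>

lemma haar_integrable:
  fixes f :: "'g::{topological_group_add,t2_space,second_countable_topology} \<Rightarrow> complex"
  assumes haar: "normalized_haar \<mu>" and cpt: "compact (UNIV :: 'g set)" and f: "continuous_on UNIV f"
  shows "integrable \<mu> f"
proof -
  have sets: "sets \<mu> = sets borel" using haar by (simp add: normalized_haar_def)
  then have space: "space \<mu> = UNIV" by (metis sets_eq_imp_space_eq space_borel)
  interpret finite_measure \<mu>
    using haar by (intro finite_measureI) (simp add: space normalized_haar_def)
  have "bounded (range f)" using compact_continuous_image[OF f cpt] by (rule compact_imp_bounded)
  then obtain B where "\<And>x. norm (f x) \<le> B" by (auto simp: bounded_iff)
  moreover have "f \<in> borel_measurable \<mu>"
    using borel_measurable_continuous_onI[OF f] measurable_cong_sets[OF sets refl] by blast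
  ultimately show ?thesis by (intro integrable_const_bound[of _ B]) auto
qed

lemma haar_integral_translate:
  fixes f :: "'g::{topological_group_add,t2_space,second_countable_topology} \<Rightarrow> complex"
  assumes haar: "normalized_haar \<mu>" and f: "continuous_on UNIV f"
  shows "(\<integral>y. f (g + y) \<partial>\<mu>) = (\<integral>y. f y \<partial>\<mu>)"
proof -
  have sets: "sets \<mu> = sets borel" using haar by (simp add: normalized_haar_def)
  have "continuous_on UNIV (\<lambda>y. g + y)" by (intro continuous_intros)
  then have "(\<lambda>y. g + y) \<in> borel_measurable \<mu>"
    using borel_measurable_continuous_onI measurable_cong_sets[OF sets refl] by blast
  then have "(\<integral>y. f (g + y) \<partial>\<mu>) = (\<integral>y. f y \<partial>(distr \<mu> borel (\<lambda>y. g + y)))"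
    using borel_measurable_continuous_onI[OF f] by (simp add: integral_distr)
  then show ?thesis using haar by (simp add: normalized_haar_def)
qed

text \<open>Unitarity moves \<open>g\<close> off \<open>a\<close> and \<open>u\<close>, turning
  \<open>y\<close> into \<open>- g + y\<close> in both factors at once; translation invariance of
  the integral then removes \<open>- g\<close>.\<close>

lemma invariant_matrix_coeff_form:
  fixes \<rho> :: "('g::{topological_group_add,t2_space,second_countable_topology}, 'v::ab_group_add) rep"
    and \<pi> :: "('g, 'w::ab_group_add) rep"
  assumes haar: "normalized_haar \<mu>" and cpt: "compact (UNIV :: 'g set)"
    and \<rho>: "unitary_rep \<rho>" and \<pi>: "unitary_rep \<pi>" and b: "b \<in> vecs \<rho>" and v: "v \<in> vecs \<pi>"
  shows "invariant_form \<rho> \<pi>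
    (\<lambda>a u. \<integral>y. inner_prod \<rho> a (act \<rho> y b) * inner_prod \<pi> (act \<pi> y v) u \<partial>\<mu>)"
proof -
  interpret R: unitary_representation \<rho> by (simp add: unitary_representation_def \<rho>)
  interpret P: unitary_representation \<pi> by (simp add: unitary_representation_def \<pi>)
  have cont: "continuous_on UNIV (\<lambda>y. inner_prod \<rho> a (act \<rho> y b) * inner_prod \<pi> (act \<pi> y v) u)"
    if "a \<in> vecs \<rho>" "u \<in> vecs \<pi>" for a u
    using that b v
    by (intro continuous_on_mult R.continuous_matrix_coeff' P.continuous_matrix_coeff)
  have "sesquilinear \<rho> \<pi> (\<lambda>a u. inner_prod \<rho> a (act \<rho> y b) * inner_prod \<pi> (act \<pi> y v) u)" for y
    using sesquilinear_rank_one[OF R.fd_hilbert P.fd_hilbert, of "act \<rho> y b" "act \<pi> y v" 1] b v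
    by simp
  then have "sesquilinear \<rho> \<pi>
      (\<lambda>a u. \<integral>y. inner_prod \<rho> a (act \<rho> y b) * inner_prod \<pi> (act \<pi> y v) u \<partial>\<mu>)"
    using cont by (intro sesquilinear_integral R.fd_hilbert P.fd_hilbert haar_integrable[OF haar cpt])
  moreover have "(\<integral>y. inner_prod \<rho> (act \<rho> g a) (act \<rho> y b) * inner_prod \<pi> (act \<pi> y v) (act \<pi> g u) \<partial>\<mu>)
      = (\<integral>y. inner_prod \<rho> a (act \<rho> y b) * inner_prod \<pi> (act \<pi> y v) u \<partial>\<mu>)"
    if a: "a \<in> vecs \<rho>" and u: "u \<in> vecs \<pi>" for g a u
  proof -
    have "inner_prod \<rho> (act \<rho> g a) (act \<rho> y b) * inner_prod \<pi> (act \<pi> y v) (act \<pi> g u)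
        = inner_prod \<rho> a (act \<rho> (- g + y) b) * inner_prod \<pi> (act \<pi> (- g + y) v) u" for y
      using a b u v
      by (simp only: R.act_plus P.act_plus R.inner_prod_act_minus' P.inner_prod_act_minus
          R.act_vecs P.act_vecs)
    then show ?thesis
      using haar_integral_translate[OF haar cont[OF a u], of "- g"] by simp
  qed
  ultimately show ?thesis by (simp add: invariant_form_def)
qed

lemma Schur_orthogonality_inequivalent:
  fixes \<rho> :: "('g::{topological_group_add,t2_space,second_countable_topology}, 'v::ab_group_add) rep"
    and \<pi> :: "('g, 'w::ab_group_add) rep"
  assumes "normalized_haar \<mu>" "compact (UNIV :: 'g set)"
    and "irreducible_rep \<rho>" "irreducible_rep \<pi>" "\<not> equivalent_reps \<rho> \<pi>"
    and "a \<in> vecs \<rho>" "b \<in> vecs \<rho>" "u \<in> vecs \<pi>" "v \<in> vecs \<pi>"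
  shows "(\<integral>y. inner_prod \<rho> a (act \<rho> y b) * inner_prod \<pi> (act \<pi> y v) u \<partial>\<mu>) = 0"
  using assms
  by (intro Schur_inequivalent[OF _ _ invariant_matrix_coeff_form]) (auto simp: irreducible_rep_def)

lemma Schur_orthogonality:
  fixes \<pi> :: "('g::{topological_group_add,t2_space,second_countable_topology}, 'v::ab_group_add) rep"
  assumes haar: "normalized_haar \<mu>" and cpt: "compact (UNIV :: 'g set)"
    and \<pi>: "irreducible_rep \<pi>"
    and a: "a \<in> vecs \<pi>" and b: "b \<in> vecs \<pi>" and u: "u \<in> vecs \<pi>" and v: "v \<in> vecs \<pi>"
  shows "(\<integral>y. inner_prod \<pi> a (act \<pi> y b) * inner_prod \<pi> (act \<pi> y v) u \<partial>\<mu>)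
    = inner_prod \<pi> a u * inner_prod \<pi> v b / of_nat (hdim \<pi>)"
proof -
  interpret P: unitary_representation \<pi>
    using \<pi> by (simp add: unitary_representation_def irreducible_rep_def)
  obtain c where c: "\<And>a u. \<lbrakk>a \<in> vecs \<pi>; u \<in> vecs \<pi>\<rbrakk> \<Longrightarrow>
      (\<integral>y. inner_prod \<pi> a (act \<pi> y b) * inner_prod \<pi> (act \<pi> y v) u \<partial>\<mu>) = c * inner_prod \<pi> a u"
    using Schur_invariant_form[OF \<pi> invariant_matrix_coeff_form[OF haar cpt P.unitary_rep P.unitary_rep b v]]
    by blast
  obtain E where E: "P.orthonormal E" "P.span E = vecs \<pi>" "card E = hdim \<pi>"
    using P.orthonormal_basis by blast
  have mem: "e \<in> vecs \<pi>" if "e \<in> E" for e using E that by (auto simp: P.orthonormal_def)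
  have "E \<noteq> {}" using E(2) \<pi> by (auto simp: irreducible_rep_def)
  \<comment> \<open>The factor \<open>c\<close> is obtained multiplied by the dimension, which must
    be nonzero for the final division.\<close>
  then have dim: "hdim \<pi> \<noteq> 0" using E by (auto simp: P.orthonormal_def simp flip: E(3))
  have "of_nat (hdim \<pi>) * c = (\<Sum>e\<in>E. c * inner_prod \<pi> e e)"
    using E by (simp add: P.orthonormal_def)
  also have "\<dots> = (\<Sum>e\<in>E. \<integral>y. inner_prod \<pi> e (act \<pi> y b) * inner_prod \<pi> (act \<pi> y v) e \<partial>\<mu>)"
    using c mem by simp
  also have "\<dots> = (\<integral>y. (\<Sum>e\<in>E. inner_prod \<pi> e (act \<pi> y b) * inner_prod \<pi> (act \<pi> y v) e) \<partial>\<mu>)"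
    using mem b v
    by (intro Bochner_Integration.integral_sum[symmetric] haar_integrable[OF haar cpt]
        continuous_on_mult P.continuous_matrix_coeff' P.continuous_matrix_coeff) auto
  \<comment> \<open>By Parseval the sum over \<open>E\<close> is the inner product of
    \<open>act \<pi> y v\<close> and \<open>act \<pi> y b\<close>. Unitarity makes it independent of
    \<open>y\<close>, and the measure has total mass 1.\<close>
  also have "\<dots> = (\<integral>y. inner_prod \<pi> v b \<partial>\<mu>)"
  proof (intro Bochner_Integration.integral_cong refl)
    fix y
    show "(\<Sum>e\<in>E. inner_prod \<pi> e (act \<pi> y b) * inner_prod \<pi> (act \<pi> y v) e) = inner_prod \<pi> v b"
      using P.Parseval[OF E(1,2), of "act \<pi> y v" "act \<pi> y b"] b v by (simp add: mult.commute)
  qed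
  also have "\<dots> = inner_prod \<pi> v b"
  proof -
    have "space \<mu> = UNIV"
      using haar by (metis normalized_haar_def sets_eq_imp_space_eq space_borel)
    then show ?thesis using haar by (simp add: normalized_haar_def measure_def)
  qed
  finally show ?thesis using c[OF a u] dim by (simp add: field_simps)
qed

section \<open>Toeplitz operators and the coefficient formula\<close>

text \<open>\<open>toeplitz\<close> is a definite description, so its defining equation is usable
  only once a unique solution is known. Existence comes from representing the integrated form by an
  operator, uniqueness from nondegeneracy of the inner product.\<close>

lemma inner_prod_toeplitz:
  fixes \<sigma> :: "('g::{topological_group_add,t2_space,second_countable_topology}, 'v::ab_group_add) rep"
  assumes haar: "normalized_haar \<mu>" and cpt: "compact (UNIV :: 'g set)"
    and \<sigma>: "unitary_rep \<sigma>" and f: "continuous_on UNIV f"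
    and p: "p \<in> vecs \<sigma>" and v: "v \<in> vecs \<sigma>" and w: "w \<in> vecs \<sigma>"
  shows "inner_prod \<sigma> (toeplitz \<mu> \<sigma> p f w) v = of_nat (hdim \<sigma>) *
    (\<integral>y. f y * inner_prod \<sigma> w (act \<sigma> y p) * cnj (inner_prod \<sigma> v (act \<sigma> y p)) \<partial>\<mu>)"
    (is "_ = ?Q w v")
  and "toeplitz \<mu> \<sigma> p f w \<in> vecs \<sigma>"
proof -
  interpret S: unitary_representation \<sigma> by (simp add: unitary_representation_def \<sigma>)
  \<comment> \<open>Replacing the conjugated coefficient by the one with swapped arguments exhibits
    the integrand as a rank-one form with scalar
    \<open>of_nat (hdim \<sigma>) * f y\<close>.\<close>
  have eq: "of_nat (hdim \<sigma>) * f y * (inner_prod \<sigma> x (act \<sigma> y p) * inner_prod \<sigma> (act \<sigma> y p) z)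
      = of_nat (hdim \<sigma>) * (f y * inner_prod \<sigma> x (act \<sigma> y p) * cnj (inner_prod \<sigma> z (act \<sigma> y p)))"
    if "z \<in> vecs \<sigma>" for x z y
    using S.inner_prod_commute[OF that S.act_vecs[OF p]] by simp
  have "sesquilinear \<sigma> \<sigma> (\<lambda>x z. \<integral>y. of_nat (hdim \<sigma>) * f y *
      (inner_prod \<sigma> x (act \<sigma> y p) * inner_prod \<sigma> (act \<sigma> y p) z) \<partial>\<mu>)"
    using p f
    by (intro sesquilinear_integral sesquilinear_rank_one S.fd_hilbert haar_integrable[OF haar cpt]
        continuous_on_mult continuous_on_const S.continuous_matrix_coeff S.continuous_matrix_coeff')
      auto
  then obtain A where A: "hlinear \<sigma> \<sigma> A"
    "\<And>x z. \<lbrakk>x \<in> vecs \<sigma>; z \<in> vecs \<sigma>\<rbrakk> \<Longrightarrow> (\<integral>y. of_nat (hdim \<sigma>) * f y *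
      (inner_prod \<sigma> x (act \<sigma> y p) * inner_prod \<sigma> (act \<sigma> y p) z) \<partial>\<mu>) = inner_prod \<sigma> (A x) z"
    using sesquilinear_representation[OF S.fd_hilbert S.fd_hilbert] by blast
  have A_vecs: "A w \<in> vecs \<sigma>" using A w by (simp add: hlinear_def)
  have A_inner: "inner_prod \<sigma> (A w) z = ?Q w z" if "z \<in> vecs \<sigma>" for z
    using A(2)[OF w that] eq[OF that] by simp
  have "toeplitz \<mu> \<sigma> p f w = A w"
    unfolding toeplitz_def
  proof (rule the_equality)
    fix x
    assume "x \<in> vecs \<sigma> \<and> (\<forall>z\<in>vecs \<sigma>. inner_prod \<sigma> x z = ?Q w z)"
    then show "x = A w"
      using A_vecs A_inner by (intro S.inner_prod_eqI) auto
  qed (use A_vecs A_inner in blast)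
  then show "inner_prod \<sigma> (toeplitz \<mu> \<sigma> p f w) v = ?Q w v" "toeplitz \<mu> \<sigma> p f w \<in> vecs \<sigma>"
    using A_vecs A_inner[OF v] by auto
qed

theorem proposition5p1:
  fixes G :: "('g::{topological_group_add,t2_space,second_countable_topology}, 'e::euclidean_space) lie_structure"
    and haar :: "'g measure"
    and T :: "'g set"
    and P :: "('e \<Rightarrow> real) set"
    and lam :: "'e \<Rightarrow> real"
    and \<sigma> :: "('g, 'v::ab_group_add) rep"
    and v\<^sub>l :: 'v
    and \<tau> :: "('g, 't::ab_group_add) rep"
    and tens :: "'v \<Rightarrow> 'v \<Rightarrow> 't"
    and R :: "('g, 'p::ab_group_add) rep set"
    and proj :: "('g, 'p) rep \<Rightarrow> nat \<Rightarrow> 't \<Rightarrow> 'p"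
    and \<pi> :: "('g, 'p) rep"
    and v\<^sub>0 u :: 'p
    and v w :: 'v
  assumes "compact_connected_lie_group G"
    and "normalized_haar haar"
    and "maximal_torus T"
    and "positive_system G T P"
    and "dominant G T P lam"
    and "analytically_integral G T lam"
    and "irreducible_rep \<sigma>"
    and "highest_weight G T P \<sigma> lam"
    and "weight_vector G T \<sigma> lam v\<^sub>l"
    and "hnorm \<sigma> v\<^sub>l = 1"
    and "tensor_product \<sigma> (conjugate \<sigma>) \<tau> tens"
    and "irreducible_decomposition \<tau> R proj"
    and "irreducible_rep \<pi>"
    and "occurs_in \<pi> \<tau>"
    and "\<pi> \<in> R"
    and "v\<^sub>0 \<in> fixed_vectors \<pi> (line_stabilizer \<sigma> v\<^sub>l)"
    and "u \<in> vecs \<pi>"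
    and "v \<in> vecs \<sigma>"
    and "w \<in> vecs \<sigma>"
  shows "inner_prod \<sigma> v (toeplitz haar \<sigma> v\<^sub>l (\<lambda>x. inner_prod \<pi> u (act \<pi> x v\<^sub>0)) w) =
    of_nat (hdim \<sigma>) / of_nat (hdim \<pi>) *
      (\<Sum>k=1..rep_multiplicity \<pi> \<tau>.
         inner_prod \<pi> (proj \<pi> k (tens v w)) u * inner_prod \<pi> v\<^sub>0 (proj \<pi> k (tens v\<^sub>l v\<^sub>l)))"
proof -
  note haar = assms(2) and tensor = assms(11) and dec = assms(12) and u = assms(17)
    and v = assms(18) and w = assms(19)
  have cpt: "compact (UNIV :: 'g set)"
    using assms(1) by (simp add: compact_connected_lie_group_def)
  interpret S: unitary_representation \<sigma>
    using assms(7) by (simp add: unitary_representation_def irreducible_rep_def)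
  interpret P: unitary_representation \<pi>
    using assms(13) by (simp add: unitary_representation_def irreducible_rep_def)
  have vl: "v\<^sub>l \<in> vecs \<sigma>" using assms(9) by (simp add: weight_vector_def)
  have v0: "v\<^sub>0 \<in> vecs \<pi>" using assms(16) by (simp add: fixed_vectors_def)
  have "hlinear \<sigma> \<tau> (\<lambda>x. tens x z)" if "z \<in> vecs \<sigma>" for z
    using tensor that by (simp add: tensor_product_def conjugate_def)
  then have tens_vecs: "tens x z \<in> vecs \<tau>" if "x \<in> vecs \<sigma>" "z \<in> vecs \<sigma>" for x z
    using that by (simp add: hlinear_def)
  \<comment> \<open>The arguments \<open>z'\<close> and \<open>z\<close> are reversed because the
    second factor carries the conjugate inner product.\<close>
  have tens_inner: "inner_prod \<tau> (tens x z) (tens x' z') = inner_prod \<sigma> x x' * inner_prod \<sigma> z' z"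
    if "x \<in> vecs \<sigma>" "z \<in> vecs \<sigma>" "x' \<in> vecs \<sigma>" "z' \<in> vecs \<sigma>" for x z x' z'
    using tensor that by (simp add: tensor_product_def conjugate_def)
  have tens_act: "act \<tau> y (tens x z) = tens (act \<sigma> y x) (act \<sigma> y z)"
    if "x \<in> vecs \<sigma>" "z \<in> vecs \<sigma>" for x z y
    using tensor that by (simp add: tensor_product_def conjugate_def)
  let ?K = "\<lambda>\<rho>. {1..rep_multiplicity \<rho> \<tau>}"
  let ?a = "\<lambda>\<rho> k. proj \<rho> k (tens v w)"
  let ?b = "\<lambda>\<rho> k. proj \<rho> k (tens v\<^sub>l v\<^sub>l)"
  let ?I = "\<lambda>\<rho> k y. inner_prod \<rho> (?a \<rho> k) (act \<rho> y (?b \<rho> k)) * inner_prod \<pi> (act \<pi> y v\<^sub>0) u"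
  have fin: "finite R" and irr: "\<forall>\<rho>\<in>R. irreducible_rep \<rho> \<and> occurs_in \<rho> \<tau>"
    and ineq: "\<forall>\<rho>\<in>R. \<forall>\<rho>'\<in>R. equivalent_reps \<rho> \<rho>' \<longrightarrow> \<rho> = \<rho>'"
    and proj: "\<forall>\<rho>\<in>R. \<forall>k\<in>?K \<rho>. intertwiner \<tau> \<rho> (proj \<rho> k)"
    and inner_dec: "\<forall>z\<in>vecs \<tau>. \<forall>z'\<in>vecs \<tau>. inner_prod \<tau> z z' =
      (\<Sum>\<rho>\<in>R. \<Sum>k\<in>?K \<rho>. inner_prod \<rho> (proj \<rho> k z) (proj \<rho> k z'))"
    using dec[unfolded irreducible_decomposition_def] by - (elim conjE, assumption)+
  have proj_vecs: "proj \<rho> k z \<in> vecs \<rho>"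
    and proj_act: "proj \<rho> k (act \<tau> y z) = act \<rho> y (proj \<rho> k z)"
    if "\<rho> \<in> R" "k \<in> ?K \<rho>" "z \<in> vecs \<tau>" for \<rho> k z y
    using proj that by (auto simp: intertwiner_def hlinear_def)
  \<comment> \<open>The two coherent-state coefficients combine into one coefficient of
    \<open>\<tau>\<close>, which the decomposition splits; equivariance of \<open>proj\<close> moves
    \<open>y\<close> past each projection.\<close>
  have coherent: "inner_prod \<sigma> v (act \<sigma> y v\<^sub>l) * inner_prod \<sigma> (act \<sigma> y v\<^sub>l) w
      = (\<Sum>\<rho>\<in>R. \<Sum>k\<in>?K \<rho>. inner_prod \<rho> (?a \<rho> k) (act \<rho> y (?b \<rho> k)))" for y
  proof -
    have "inner_prod \<sigma> v (act \<sigma> y v\<^sub>l) * inner_prod \<sigma> (act \<sigma> y v\<^sub>l) w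
        = inner_prod \<tau> (tens v w) (act \<tau> y (tens v\<^sub>l v\<^sub>l))"
      using v w vl by (simp add: tens_act tens_inner)
    also have "\<dots> = (\<Sum>\<rho>\<in>R. \<Sum>k\<in>?K \<rho>. inner_prod \<rho> (?a \<rho> k) (proj \<rho> k (act \<tau> y (tens v\<^sub>l v\<^sub>l))))"
      using v w vl by (intro inner_dec[rule_format]) (simp_all add: tens_act tens_vecs)
    also have "\<dots> = (\<Sum>\<rho>\<in>R. \<Sum>k\<in>?K \<rho>. inner_prod \<rho> (?a \<rho> k) (act \<rho> y (?b \<rho> k)))"
      using vl by (intro sum.cong refl) (simp add: proj_act tens_vecs)
    finally show ?thesis .
  qed
  have int: "integrable haar (?I \<rho> k)" if "\<rho> \<in> R" "k \<in> ?K \<rho>" for \<rho> k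
  proof -
    interpret r: unitary_representation \<rho>
      using irr that(1) by (simp add: unitary_representation_def irreducible_rep_def)
    show ?thesis
      using that v w vl v0 u
      by (intro haar_integrable[OF haar cpt] continuous_on_mult r.continuous_matrix_coeff'
          P.continuous_matrix_coeff proj_vecs tens_vecs)
  qed
  have val: "(\<integral>y. ?I \<rho> k y \<partial>haar) = (if \<rho> = \<pi> then
      inner_prod \<pi> (?a \<pi> k) u * inner_prod \<pi> v\<^sub>0 (?b \<pi> k) / of_nat (hdim \<pi>) else 0)"
    if "\<rho> \<in> R" "k \<in> ?K \<rho>" for \<rho> k
  proof -
    have a: "?a \<rho> k \<in> vecs \<rho>" and b: "?b \<rho> k \<in> vecs \<rho>"
      using proj_vecs[OF that] tens_vecs v w vl by auto
    show ?thesis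
    proof (cases "\<rho> = \<pi>")
      case True
      then show ?thesis
        using Schur_orthogonality[OF haar cpt assms(13) _ _ u v0] a b by simp
    next
      case False
      \<comment> \<open>\<open>R\<close> holds only one representative of each class, so distinct
        members are inequivalent.\<close>
      then have "\<not> equivalent_reps \<rho> \<pi>" using ineq that(1) \<open>\<pi> \<in> R\<close> by blast
      moreover have "irreducible_rep \<rho>" using irr that(1) by blast
      ultimately show ?thesis
        using Schur_orthogonality_inequivalent[OF haar cpt _ assms(13) _ a b u v0] False by simp
    qed
  qed
  let ?f = "\<lambda>x. inner_prod \<pi> u (act \<pi> x v\<^sub>0)"
  have f: "continuous_on UNIV ?f" by (intro P.continuous_matrix_coeff' u v0)
  note T = inner_prod_toeplitz[OF haar cpt S.unitary_rep f vl v w]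
  \<comment> \<open>The operator stands in the second argument here but in the first in its defining
    equation. The resulting conjugation turns the symbol into
    \<open>inner_prod \<pi> (act \<pi> y v\<^sub>0) u\<close>, the order that Schur orthogonality
    expects.\<close>
  have "inner_prod \<sigma> v (toeplitz haar \<sigma> v\<^sub>l ?f w) = cnj (inner_prod \<sigma> (toeplitz haar \<sigma> v\<^sub>l ?f w) v)"
    by (rule S.inner_prod_commute[OF T(2) v])
  also have "\<dots> = of_nat (hdim \<sigma>) * (\<integral>y. cnj (?f y * inner_prod \<sigma> w (act \<sigma> y v\<^sub>l) *
      cnj (inner_prod \<sigma> v (act \<sigma> y v\<^sub>l))) \<partial>haar)"
    unfolding T(1) Bochner_Integration.integral_cnj by simp
  also have "(\<integral>y. cnj (?f y * inner_prod \<sigma> w (act \<sigma> y v\<^sub>l) *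
      cnj (inner_prod \<sigma> v (act \<sigma> y v\<^sub>l))) \<partial>haar) = (\<integral>y. (\<Sum>\<rho>\<in>R. \<Sum>k\<in>?K \<rho>. ?I \<rho> k y) \<partial>haar)"
  proof (intro Bochner_Integration.integral_cong refl)
    fix y
    have "cnj (?f y * inner_prod \<sigma> w (act \<sigma> y v\<^sub>l) * cnj (inner_prod \<sigma> v (act \<sigma> y v\<^sub>l)))
        = (inner_prod \<sigma> v (act \<sigma> y v\<^sub>l) * inner_prod \<sigma> (act \<sigma> y v\<^sub>l) w) * inner_prod \<pi> (act \<pi> y v\<^sub>0) u"
      using S.inner_prod_commute[OF w S.act_vecs[OF vl]] P.inner_prod_commute[OF u P.act_vecs[OF v0]]
      by simp
    then show "cnj (?f y * inner_prod \<sigma> w (act \<sigma> y v\<^sub>l) * cnj (inner_prod \<sigma> v (act \<sigma> y v\<^sub>l)))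
        = (\<Sum>\<rho>\<in>R. \<Sum>k\<in>?K \<rho>. ?I \<rho> k y)"
      unfolding coherent sum_distrib_right .
  qed
  also have "\<dots> = (\<Sum>\<rho>\<in>R. \<integral>y. (\<Sum>k\<in>?K \<rho>. ?I \<rho> k y) \<partial>haar)"
    by (intro Bochner_Integration.integral_sum Bochner_Integration.integrable_sum int)
  also have "\<dots> = (\<Sum>\<rho>\<in>R. \<Sum>k\<in>?K \<rho>. \<integral>y. ?I \<rho> k y \<partial>haar)"
    by (intro sum.cong refl Bochner_Integration.integral_sum int)
  also have "\<dots> = (\<Sum>\<rho>\<in>R. if \<rho> = \<pi> then \<Sum>k\<in>?K \<pi>.
      inner_prod \<pi> (?a \<pi> k) u * inner_prod \<pi> v\<^sub>0 (?b \<pi> k) / of_nat (hdim \<pi>) else 0)"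
    using val by (intro sum.cong refl) simp
  \<comment> \<open>Since \<open>\<pi>\<close> itself is the representative of its class in the
    finite set \<open>R\<close>, exactly its summand remains.\<close>
  also have "\<dots> = (\<Sum>k\<in>?K \<pi>.
      inner_prod \<pi> (?a \<pi> k) u * inner_prod \<pi> v\<^sub>0 (?b \<pi> k) / of_nat (hdim \<pi>))"
    using fin \<open>\<pi> \<in> R\<close> by simp
  finally show ?thesis
    by (simp add: sum_divide_distrib[symmetric])
qed

end
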